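(* Let $\mu$ be a nonzero finite Borel measure on $S^{n-1}$ not concentrated on any closed hemisphere. Let $G:(0,\infty)\times S^{n-1}\to(0,\infty)$ be such that $G$ and $G_t=\partial G/\partial t$ are continuous on $(0,\infty)\times S^{n-1}$ and $G_t<0$ on $(0,\infty)\times S^{n-1}$. Let $0<\varepsilon_0<1$ and suppose that for all $v\in S^{n-1}$ and $0<\varepsilon\le\varepsilon_0$, $$\lim_{t\to 0+}\int_{\Sigma_\varepsilon(v)}G(t,u)\,du=\infty\qquad\text{and}\qquad \lim_{t\to\infty}\int_{S^{n-1}}G(t,u)\,du=0,$$ where $\Sigma_\varepsilon(v)=\{u\in S^{n-1}:\langle u,v\rangle\ge\varepsilon\}$. Let $\psi:(0,\infty)\to(0,\infty)$ be continuous and satisfy $$\int_1^\infty\frac{\psi(s)}{s}\,ds=\infty.$$ Then there exists $K\in\mathcal{K}_o^n$ such that $$\frac{\mu}{|\mu|}=\frac{\widetilde{C}_{G,\psi}(K,\cdot)}{\widetilde{C}_{G,\psi}(K,S^{n-1})}.$$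
   Context: $\mathcal{K}_o^n$ is the class of compact convex sets in $\mathbb{R}^n$ containing the origin $o$ in their interiors. Integration on the unit sphere $S^{n-1}$ is with respect to $du=d\mathcal{H}^{n-1}(u)$ (spherical Lebesgue measure). For a finite Borel measure $\mu$ on $S^{n-1}$, $|\mu|=\mu(S^{n-1})$, and $\mu$ is not concentrated on any closed hemisphere if $\int_{S^{n-1}}\max\{\langle u,v\rangle,0\}\,d\mu(u)>0$ for all $v\in S^{n-1}$. For $K\in\mathcal{K}_o^n$: $h_K(u)=\sup_{x\in K}\langle u,x\rangle$ is the support function; $\rho_K(u)=\sup\{\lambda>0:\lambda u\in K\}$ is the radial function; $H(K,u)=\{x:\langle x,u\rangle=h_K(u)\}$; for $\mathcal{H}^{n-1}$-almost all $u\in S^{n-1}$, $\alpha_K(u)$ denotes the unique outer unit normal vector of $K$ at the boundary point $\rho_K(u)u$; and for $E\subset S^{n-1}$, $\boldsymbol{\alpha}_K^*(E)=\{x/|x|: x\in\partial K\cap H(K,u)\text{ for some }u\in E\}$. The general dual Orlicz curvature measure of $K$ is the finite signed Borel measure on $S^{n-1}$ given by $$\widetilde{C}_{G,\psi}(K,E)=\frac1n\int_{\boldsymbol{\alpha}_K^*(E)}\frac{\rho_K(u)\,G_t(\rho_K(u),u)}{\psi(h_K(\alpha_K(u)))}\,du$$ for Borel sets $E\subset S^{n-1}$. *)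

theory Defs
  imports "HOL-Analysis.Analysis"
begin

(* Normalised Hausdorff measures H^k for a natural number k.  The constant is the one for which
   H^n is Lebesgue measure on n-dimensional Euclidean space and H^(n-1) is surface area.  For
   k = 0 a nonempty set has weight 1 (0 ^ 0 = 1), but the empty set must still have weight 0. *)

definition hausdorff_weight :: "nat \<Rightarrow> 'a::metric_space set \<Rightarrow> ennreal" where
  "hausdorff_weight k U =
     (if U = {} then 0 else ennreal (unit_ball_vol (real k) * (diameter U / 2) ^ k))"

definition hausdorff_premeasure :: "nat \<Rightarrow> real \<Rightarrow> 'a::metric_space set \<Rightarrow> ennreal" where
  "hausdorff_premeasure k \<delta> A =
     (INF U \<in> {U :: nat \<Rightarrow> 'a set. A \<subseteq> (\<Union>i. U i) \<and> (\<forall>i. bounded (U i) \<and> diameter (U i) \<le> \<delta>)}.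
        \<Sum>i. hausdorff_weight k (U i))"

definition hausdorff_outer :: "nat \<Rightarrow> 'a::metric_space set \<Rightarrow> ennreal" where
  "hausdorff_outer k A = (SUP \<delta> \<in> {0<..}. hausdorff_premeasure k \<delta> A)"

(* The outer measure H^k is a metric outer measure, hence countably additive on the Borel sets. *)

definition hausdorff_measure :: "nat \<Rightarrow> 'a::metric_space measure" where
  "hausdorff_measure k = measure_of UNIV (sets borel) (hausdorff_outer k)"

(* The completion is needed because the sets reverse_radial_gauss_image K E below are in general only
   H^(n-1)-measurable, not Borel, for Borel E. *)

definition sphere_measure :: "'a::euclidean_space measure" where
  "sphere_measure =
     completion (restrict_space (hausdorff_measure (DIM('a) - 1)) (sphere 0 1))"

definition finite_Borel_measure_on_sphere :: "'a::euclidean_space measure \<Rightarrow> bool" where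
  "finite_Borel_measure_on_sphere \<mu> \<longleftrightarrow>
     sets \<mu> = sets (restrict_space borel (sphere 0 1)) \<and> finite_measure \<mu>"

definition not_concentrated_on_closed_hemisphere :: "'a::euclidean_space measure \<Rightarrow> bool" where
  "not_concentrated_on_closed_hemisphere \<mu> \<longleftrightarrow>
     (\<forall>v \<in> sphere 0 1. 0 < (LINT u|\<mu>. max (u \<bullet> v) 0))"

definition sphere_cap :: "real \<Rightarrow> 'a::euclidean_space \<Rightarrow> 'a set" where
  "sphere_cap \<epsilon> v = {u \<in> sphere 0 1. \<epsilon> \<le> u \<bullet> v}"

definition convex_bodies_o :: "'a::euclidean_space set set" where
  "convex_bodies_o = {K. compact K \<and> convex K \<and> 0 \<in> interior K}"

definition support_fun :: "'a::euclidean_space set \<Rightarrow> 'a \<Rightarrow> real" where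
  "support_fun K u = (SUP x\<in>K. u \<bullet> x)"

definition radial_fun :: "'a::euclidean_space set \<Rightarrow> 'a \<Rightarrow> real" where
  "radial_fun K u = Sup {r. 0 < r \<and> r *\<^sub>R u \<in> K}"

definition support_hyperplane :: "'a::euclidean_space set \<Rightarrow> 'a \<Rightarrow> 'a set" where
  "support_hyperplane K u = {x. x \<bullet> u = support_fun K u}"

definition outer_unit_normal :: "'a::euclidean_space set \<Rightarrow> 'a \<Rightarrow> 'a \<Rightarrow> bool" where
  "outer_unit_normal K x v \<longleftrightarrow> v \<in> sphere 0 1 \<and> (\<forall>y\<in>K. (y - x) \<bullet> v \<le> 0)"

(* For K in convex_bodies_o the normal is unique for H^(n-1)-almost all u in the sphere; the
   unspecified value on the exceptional null set does not affect the integral below. *)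

definition radial_gauss_map :: "'a::euclidean_space set \<Rightarrow> 'a \<Rightarrow> 'a" where
  "radial_gauss_map K u = (THE v. outer_unit_normal K (radial_fun K u *\<^sub>R u) v)"

definition reverse_radial_gauss_image :: "'a::euclidean_space set \<Rightarrow> 'a set \<Rightarrow> 'a set" where
  "reverse_radial_gauss_image K E =
     {x /\<^sub>R norm x | x. x \<in> frontier K \<and> (\<exists>u\<in>E. x \<in> support_hyperplane K u)}"

definition partial_t :: "(real \<Rightarrow> 'a \<Rightarrow> real) \<Rightarrow> real \<Rightarrow> 'a \<Rightarrow> real" where
  "partial_t G t u = deriv (\<lambda>s. G s u) t"

definition dual_Orlicz_curvature_measure ::
  "(real \<Rightarrow> 'a::euclidean_space \<Rightarrow> real) \<Rightarrow> (real \<Rightarrow> real) \<Rightarrow> 'a set \<Rightarrow> 'a set \<Rightarrow> real" where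
  "dual_Orlicz_curvature_measure G \<psi> K E =
     1 / real DIM('a) *
     (LINT u : reverse_radial_gauss_image K E | sphere_measure.
        radial_fun K u * partial_t G (radial_fun K u) u
          / \<psi> (support_fun K (radial_gauss_map K u)))"

end

theory Submission
  imports Defs "HOL-Complex_Analysis.Great_Picard"
begin

text \<open>
  The body is found by minimising an entropy under a constraint on a dual volume. Let \<open>\<phi>\<close> be the
  primitive of \<open>\<psi> s / s\<close>. Among the convex bodies \<open>K\<close> with the origin in the interior whose dual
  volume, the integral of \<open>G (\<rho> u) u\<close> over the sphere with \<open>\<rho>\<close> the radial function of \<open>K\<close>, is at most
  that of the unit ball, one minimises the integral of \<open>\<phi> \<circ> h\<close> with respect to \<open>\<mu>\<close>, where \<open>h\<close> is the
  support function of \<open>K\<close>.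

  A minimiser exists (\<open>entropy_minimiser_exists\<close>) because both ways of degenerating are excluded. If
  \<open>K\<close> is thin in direction \<open>v\<close>, then \<open>\<rho>\<close> is small on a cap around \<open>v\<close> and the dual volume is large;
  so the constraint bounds \<open>h\<close> away from zero (\<open>support_fun_lower_bound\<close>). If \<open>K\<close> has a far point, then
  \<open>h\<close> is large on a cap of a definite \<open>\<mu>\<close>-mass, because \<open>\<mu>\<close> is not concentrated on a closed hemisphere,
  and the entropy is large because \<open>\<phi>\<close> is unbounded (\<open>entropy_coercive\<close>). What remains is compact by
  the theorem of Arzela and Ascoli.

  At a minimiser \<open>K\<close>, replace \<open>h\<close> by \<open>h * exp (t * g)\<close> for a continuous \<open>g\<close> and let \<open>K\<^sub>t\<close> be the Wulff
  shape. The radial function of \<open>K\<^sub>t\<close> at \<open>u\<close> is the minimum of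
  \<open>h v * exp (t * g v) / (u \<bullet> v)\<close> over the \<open>v\<close> with \<open>0 < u \<bullet> v\<close>, so by the envelope theorem its logarithmic derivative at \<open>t = 0\<close> is
  the value of \<open>g\<close> at the outer normal \<open>\<alpha> u\<close>, provided that this normal is unique
  (\<open>log_radial_rate_tendsto\<close>). Hence the first variations of entropy and dual volume are the integral of
  \<open>\<psi> (h v) * g v\<close> with respect to \<open>\<mu>\<close> and the integral of \<open>\<rho> u * G\<^sub>t (\<rho> u) u * g (\<alpha> u)\<close> over the
  sphere, where \<open>G\<^sub>t\<close> is the derivative of \<open>G\<close> in its first argument. By minimality they are proportional (\<open>rates_proportional\<close>), and with \<open>g\<close> replaced by
  \<open>g / (\<psi> \<circ> h)\<close> this says that \<open>\<mu>\<close> is a multiple of the curvature measure of \<open>K\<close>.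

  Two facts on the spherical measure are needed. It is finite: the integrals of \<open>G\<close> over caps are not
  zero for small \<open>t\<close>, hence they exist, and \<open>G\<close> is bounded below
  (\<open>emeasure_sphere_finite\<close>). And almost every direction has a unique normal. For this, fix a
  compact set, a vector \<open>e\<close> and a gap, and consider the directions \<open>u\<close> for which \<open>w \<bullet> u\<close> has two
  maximisers \<open>w\<close> in the compact set whose components along \<open>e\<close> lie on either side of the gap. Shifting these directions by small multiples of \<open>e\<close>
  and projecting back to the sphere gives disjoint sets, because the component of the maximiser along
  \<open>e\<close> is monotone along lines parallel to \<open>e\<close>. The shifts contract distances at most by the factor 2, so
  infinitely many disjoint sets would have measure bounded below, unless all are null
  (\<open>kinked_directions_null\<close>). The outer normals are turned into such maximisers in
  \<open>singular_directions_null\<close>.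
\<close>

section \<open>The Hausdorff measure on the sphere\<close>

lemma ennreal_divide_le_iff:
  "0 < r \<Longrightarrow> a / ennreal r \<le> b \<longleftrightarrow> a \<le> ennreal r * b"
proof
  assume r: "0 < r"
  then have [simp]: "ennreal r \<noteq> 0" by (simp add: ennreal_eq_0_iff)
  show "a \<le> ennreal r * b" if "a / ennreal r \<le> b"
  proof -
    have "a = ennreal r * a / ennreal r" by (simp add: mult_divide_eq_ennreal mult.commute)
    also have "\<dots> = ennreal r * (a / ennreal r)" by (simp add: ennreal_times_divide)
    also have "\<dots> \<le> ennreal r * b" using that by (intro mult_left_mono) auto
    finally show ?thesis .
  qed
  show "a / ennreal r \<le> b" if "a \<le> ennreal r * b"
    using r that by (intro divide_le_posI_ennreal) auto
qed

lemma hausdorff_weight_image_le: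
  fixes p :: "'a::metric_space \<Rightarrow> 'b::metric_space"
  assumes "bounded U" and L: "0 < L"
    and p: "\<And>x y. x \<in> U \<Longrightarrow> y \<in> U \<Longrightarrow> dist (p x) (p y) \<le> L * dist x y"
  shows "bounded (p ` U)" "diameter (p ` U) \<le> L * diameter U"
    "hausdorff_weight k (p ` U) \<le> ennreal (L ^ k) * hausdorff_weight k U"
proof -
  have *: "dist x y \<le> L * diameter U" if "x \<in> p ` U" "y \<in> p ` U" for x y
    using that p diameter_bounded_bound[OF \<open>bounded U\<close>] L
    by (smt (verit) imageE mult_left_mono)
  show "bounded (p ` U)"
    using * unfolding bounded_two_points by blast
  have d0: "0 \<le> diameter U" by (rule diameter_ge_0) fact
  show d: "diameter (p ` U) \<le> L * diameter U"
  proof (cases "U = {}")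
    case False
    then show ?thesis
      unfolding diameter_def[of "p ` U"]
      by (simp only: image_is_empty if_False, intro cSUP_least) (use * in auto)
  qed (simp add: diameter_def)
  show "hausdorff_weight k (p ` U) \<le> ennreal (L ^ k) * hausdorff_weight k U"
  proof (cases "U = {}")
    case False
    have "(diameter (p ` U) / 2) ^ k \<le> (L * diameter U / 2) ^ k"
      using d diameter_ge_0[OF \<open>bounded (p ` U)\<close>] by (intro power_mono) auto
    also have "\<dots> = L ^ k * (diameter U / 2) ^ k"
      by (simp add: power_mult_distrib power_divide)
    finally have "unit_ball_vol (real k) * (diameter (p ` U) / 2) ^ k
        \<le> L ^ k * (unit_ball_vol (real k) * (diameter U / 2) ^ k)"
      using unit_ball_vol_nonneg[of "real k"] by (simp add: mult_left_mono mult.left_commute)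
    then show ?thesis
      using False L d0 unit_ball_vol_nonneg[of "real k"]
      by (simp add: hausdorff_weight_def flip: ennreal_mult) 
  qed (simp add: hausdorff_weight_def)
qed

text \<open>A map with Lipschitz constant \<open>L\<close> carries a cover to a cover whose pieces are at most
  \<open>L\<close> times as wide.\<close>

lemma hausdorff_outer_lipschitz_image:
  fixes p :: "'a::metric_space \<Rightarrow> 'b::metric_space"
  assumes L: "0 < L"
    and p: "\<And>x y. x \<in> A \<Longrightarrow> y \<in> A \<Longrightarrow> dist (p x) (p y) \<le> L * dist x y"
  shows "hausdorff_outer k (p ` A) \<le> ennreal (L ^ k) * hausdorff_outer k A"
proof -
  have "hausdorff_premeasure k \<delta> (p ` A) \<le> ennreal (L ^ k) * hausdorff_outer k A"
    if "0 < \<delta>" for \<delta>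
  proof -
    have "hausdorff_premeasure k \<delta> (p ` A) / ennreal (L ^ k) \<le> hausdorff_premeasure k (\<delta> / L) A"
      unfolding hausdorff_premeasure_def[of k "\<delta> / L"]
    proof (intro INF_greatest)
      fix U :: "nat \<Rightarrow> 'a set"
      assume "U \<in> {U. A \<subseteq> (\<Union>i. U i) \<and> (\<forall>i. bounded (U i) \<and> diameter (U i) \<le> \<delta> / L)}"
      then have U: "A \<subseteq> (\<Union>i. U i)" "bounded (U i)" "diameter (U i) \<le> \<delta> / L" for i by auto
      define W where "W i = p ` (U i \<inter> A)" for i
      have bd: "bounded (U i \<inter> A)" for i using U(2) by (simp add: bounded_Int)
      have diam: "diameter (U i \<inter> A) \<le> diameter (U i)" for i
        by (intro diameter_subset U) auto
      have wt: "hausdorff_weight k (U i \<inter> A) \<le> hausdorff_weight k (U i)" for i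
        using diam[of i] diameter_ge_0[OF bd] unit_ball_vol_nonneg[of "real k"]
        by (auto simp: hausdorff_weight_def intro!: ennreal_leI mult_left_mono power_mono)
      have W: "bounded (W i)" "diameter (W i) \<le> L * diameter (U i \<inter> A)"
        "hausdorff_weight k (W i) \<le> ennreal (L ^ k) * hausdorff_weight k (U i \<inter> A)" for i
        unfolding W_def
        by (rule hausdorff_weight_image_le[OF bd L]; use p in blast)+
      have "diameter (W i) \<le> \<delta>" for i :: nat
      proof -
        have "diameter (W i) \<le> L * (\<delta> / L)"
          using W(2)[of i] U(3)[of i] diam[of i] L by (meson mult_left_mono less_imp_le order_trans)
        then show ?thesis using L by simp
      qed
      moreover have "p ` A \<subseteq> (\<Union>i. W i)" using U(1) unfolding W_def by blast
      ultimately have "hausdorff_premeasure k \<delta> (p ` A) \<le> (\<Sum>i. hausdorff_weight k (W i))"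
        unfolding hausdorff_premeasure_def using W(1) by (intro INF_lower) auto
      also have "\<dots> \<le> (\<Sum>i. ennreal (L ^ k) * hausdorff_weight k (U i))"
        by (intro suminf_le order_trans[OF W(3) mult_left_mono[OF wt]]) auto
      also have "\<dots> = ennreal (L ^ k) * (\<Sum>i. hausdorff_weight k (U i))" by simp
      finally show "hausdorff_premeasure k \<delta> (p ` A) / ennreal (L ^ k)
          \<le> (\<Sum>i. hausdorff_weight k (U i))"
        using L by (simp add: ennreal_divide_le_iff)
    qed
    also have "\<dots> \<le> hausdorff_outer k A"
      unfolding hausdorff_outer_def using \<open>0 < \<delta>\<close> L by (intro SUP_upper) auto
    finally show ?thesis
      using L by (simp add: ennreal_divide_le_iff)
  qed
  then show ?thesis
    unfolding hausdorff_outer_def[of k "p ` A"] by (intro SUP_least) auto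
qed

lemma space_sphere_measure: "space (sphere_measure :: 'a::euclidean_space measure) = sphere 0 1"
  by (simp add: sphere_measure_def space_restrict_space hausdorff_measure_def)

lemma sets_hausdorff_measure: "sets (hausdorff_measure k) = sets borel"
  using sets.sigma_sets_eq[of borel, unfolded space_borel] by (simp add: hausdorff_measure_def)

lemma borel_subset_in_sets_sphere_measure:
  fixes B :: "'a::euclidean_space set"
  assumes "B \<in> sets borel" "B \<subseteq> sphere 0 1"
  shows "B \<in> sets sphere_measure"
    "B \<in> sets (restrict_space (hausdorff_measure (DIM('a) - 1)) (sphere 0 1))"
proof -
  show *: "B \<in> sets (restrict_space (hausdorff_measure (DIM('a) - 1)) (sphere 0 1))"
    using assms by (subst sets_restrict_space_iff) (auto simp: sets_hausdorff_measure)
  then show "B \<in> sets sphere_measure"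
    unfolding sphere_measure_def by simp
qed

lemma measurable_sphere_measure_of_borel:
  assumes "f \<in> measurable (restrict_space borel (sphere (0::'a::euclidean_space) 1)) M"
  shows "f \<in> measurable sphere_measure M"
proof -
  have "sets (restrict_space (hausdorff_measure (DIM('a) - 1)) (sphere (0::'a) 1))
      = sets (restrict_space borel (sphere 0 1))"
    by (intro sets_restrict_space_cong sets_hausdorff_measure)
  then have "f \<in> measurable (restrict_space (hausdorff_measure (DIM('a) - 1)) (sphere 0 1)) M"
    using assms measurable_cong_sets by blast
  then show ?thesis unfolding sphere_measure_def by (rule measurable_completion)
qed

text \<open>A measure built from a set function that fails to be countably additive is zero by
  convention, so the comparison below needs only the Lipschitz bound for the outer measure.\<close>

lemma emeasure_sphere_measure_lipschitz_image:
  fixes p :: "'a::euclidean_space \<Rightarrow> 'a"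
  assumes L: "0 < L"
    and p: "\<And>x y. x \<in> A \<Longrightarrow> y \<in> A \<Longrightarrow> dist (p x) (p y) \<le> L * dist x y"
    and A: "A \<in> sets borel" "A \<subseteq> sphere 0 1"
    and pA: "p ` A \<in> sets borel" "p ` A \<subseteq> sphere 0 1"
  shows "emeasure sphere_measure (p ` A) \<le> ennreal (L ^ (DIM('a) - 1)) * emeasure sphere_measure A"
proof -
  let ?k = "DIM('a) - 1"
  have eq: "emeasure sphere_measure B = emeasure (hausdorff_measure ?k) B"
    if "B \<in> sets borel" "B \<subseteq> sphere 0 1" for B :: "'a set"
    using borel_subset_in_sets_sphere_measure[OF that] that
    unfolding sphere_measure_def
    by (subst emeasure_completion) (auto simp: emeasure_restrict_space sets_hausdorff_measure)
  have "(\<forall>B \<in> sets borel. emeasure (hausdorff_measure ?k) B = hausdorff_outer ?k (B :: 'a set)) \<or>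
      (\<forall>B. emeasure (hausdorff_measure ?k) (B :: 'a set) = 0)"
    using sets.sigma_sets_eq[of "borel :: 'a measure", unfolded space_borel]
    unfolding hausdorff_measure_def emeasure_measure_of_conv by auto
  then show ?thesis
  proof
    assume *: "\<forall>B \<in> sets borel. emeasure (hausdorff_measure ?k) B = hausdorff_outer ?k (B :: 'a set)"
    show ?thesis
      unfolding eq[OF A] eq[OF pA] *[rule_format, OF A(1)] *[rule_format, OF pA(1)]
      by (rule hausdorff_outer_lipschitz_image[OF L p])
  qed (simp add: eq[OF pA])
qed

lemma null_subset_sphere_measure:
  assumes "N \<in> null_sets sphere_measure" "M \<subseteq> N"
  shows "M \<in> null_sets sphere_measure"
  using null_sets_completion_subset[of M N] assms unfolding sphere_measure_def by auto

text \<open>Completeness: subsets of null sets are measurable.\<close>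

lemma measurable_sphere_measure_modify_null:
  assumes f: "f \<in> measurable sphere_measure M" and N: "N \<in> null_sets sphere_measure"
    and eq: "\<And>x. x \<in> sphere 0 1 \<Longrightarrow> x \<notin> N \<Longrightarrow> h x = f x"
    and sp: "\<And>x. x \<in> sphere 0 1 \<Longrightarrow> h x \<in> space M"
  shows "h \<in> measurable sphere_measure M"
proof (rule measurableI)
  fix A assume A: "A \<in> sets M"
  have "h -` A \<inter> space sphere_measure
      = ((f -` A \<inter> space sphere_measure) - N) \<union> (h -` A \<inter> N \<inter> sphere 0 1)"
    using eq by (auto simp: space_sphere_measure)
  moreover have "h -` A \<inter> N \<inter> sphere 0 1 \<in> null_sets sphere_measure"
    by (rule null_subset_sphere_measure[OF N]) auto
  ultimately show "h -` A \<inter> space sphere_measure \<in> sets sphere_measure"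
    using sets.Un[OF sets.Diff[OF measurable_sets[OF f A] null_setsD2[OF N]]] by auto
qed (use sp in \<open>auto simp: space_sphere_measure\<close>)

section \<open>Directions with several maximisers\<close>

definition support_face :: "'a::euclidean_space set \<Rightarrow> 'a \<Rightarrow> 'a set" where
  "support_face P u = {w \<in> P. \<forall>p\<in>P. p \<bullet> u \<le> w \<bullet> u}"

definition shifted_direction :: "real \<Rightarrow> 'a::euclidean_space \<Rightarrow> 'a \<Rightarrow> 'a" where
  "shifted_direction s e u = sgn (u + s *\<^sub>R e)"

lemma norm_shift_bounds:
  fixes u e :: "'a::euclidean_space"
  assumes "norm u = 1" "norm e = 1" "0 \<le> s" "s \<le> 1/4"
  shows "3/4 \<le> norm (u + s *\<^sub>R e)" "norm (u + s *\<^sub>R e) \<le> 5/4"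
proof -
  have "norm (s *\<^sub>R e) \<le> 1/4" using assms by simp
  then show "3/4 \<le> norm (u + s *\<^sub>R e)" "norm (u + s *\<^sub>R e) \<le> 5/4"
    using norm_triangle_ineq[of u "s *\<^sub>R e"] norm_diff_ineq[of u "s *\<^sub>R e"] assms(1) by linarith+
qed

text \<open>The squared lengths of the two shifted vectors differ by \<open>2 * s * (e \<bullet> (u - u'))\<close>, so their
  lengths differ by at most a third of the distance from \<open>u\<close> to \<open>u'\<close>. The rest of that distance
  has to show up in their directions.\<close>

lemma dist_le_shifted_direction:
  fixes u u' e :: "'a::euclidean_space"
  assumes u: "norm u = 1" "norm u' = 1" and e: "norm e = 1" and s: "0 \<le> s" "s \<le> 1/4"
  shows "dist u u' \<le> 2 * dist (shifted_direction s e u) (shifted_direction s e u')"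
proof -
  define a b where "a = u + s *\<^sub>R e" and "b = u' + s *\<^sub>R e"
  have ab: "3/4 \<le> norm a" "norm a \<le> 5/4" "3/4 \<le> norm b" "norm b \<le> 5/4"
    unfolding a_def b_def using norm_shift_bounds u e s by blast+
  have "(norm a)\<^sup>2 - (norm b)\<^sup>2 = 2 * s * (e \<bullet> (u - u'))"
    using u unfolding a_def b_def power2_norm_eq_inner norm_eq_1
    by (simp add: algebra_simps inner_commute)
  then have "\<bar>norm a - norm b\<bar> * (norm a + norm b) = \<bar>2 * s * (e \<bullet> (u - u'))\<bar>"
  proof -
    have "\<bar>norm a - norm b\<bar> * (norm a + norm b) = \<bar>(norm a)\<^sup>2 - (norm b)\<^sup>2\<bar>"
      by (simp add: power2_eq_square square_diff_square_factored abs_mult)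
    then show ?thesis using \<open>(norm a)\<^sup>2 - (norm b)\<^sup>2 = _\<close> by simp
  qed
  also have "\<dots> \<le> 1/2 * norm (u - u')"
    using s e Cauchy_Schwarz_ineq2[of e "u - u'"] mult_mono[of s "1/4" "\<bar>e \<bullet> (u - u')\<bar>" "norm (u - u')"]
    by (simp add: abs_mult)
  finally have "\<bar>norm a - norm b\<bar> * (3/2) \<le> 1/2 * norm (u - u')"
    using ab mult_left_mono[of "3/2" "norm a + norm b" "\<bar>norm a - norm b\<bar>"] by linarith
  moreover have "norm (u - u') \<le> norm a * norm (sgn a - sgn b) + \<bar>norm a - norm b\<bar>"
  proof -
    have "norm a \<noteq> 0" "norm b \<noteq> 0" using ab by linarith+
    then have "b = norm b *\<^sub>R sgn b" "a = norm a *\<^sub>R sgn a" by (auto simp: sgn_div_norm)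
    then have "u - u' = norm a *\<^sub>R (sgn a - sgn b) + (norm a - norm b) *\<^sub>R sgn b"
      unfolding scaleR_diff_right scaleR_diff_left a_def b_def by (simp add: algebra_simps)
    moreover have "norm (sgn b) = 1" using ab by (auto simp: norm_sgn)
    ultimately show ?thesis
      using norm_triangle_ineq[of "norm a *\<^sub>R (sgn a - sgn b)" "(norm a - norm b) *\<^sub>R sgn b"]
      by simp
  qed
  moreover have "norm a * norm (sgn a - sgn b) \<le> 5/4 * norm (sgn a - sgn b)"
    using ab by (intro mult_right_mono) auto
  moreover have "0 \<le> norm (sgn a - sgn b)" by simp
  moreover have "N \<le> 2 * X" if "D * (3/2) \<le> 1/2 * N" "N \<le> A + D" "A \<le> 5/4 * X" "0 \<le> X"
    for D N A X :: real
    using that by linarith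
  ultimately have "norm (u - u') \<le> 2 * norm (sgn a - sgn b)" by blast
  then show ?thesis
    by (simp add: dist_norm shifted_direction_def flip: a_def b_def)
qed

lemma continuous_on_shifted_direction:
  assumes "norm e = 1" "0 \<le> s" "s \<le> 1/4"
  shows "continuous_on (sphere (0::'a::euclidean_space) 1) (shifted_direction s e)"
  unfolding shifted_direction_def sgn_div_norm
proof (intro continuous_intros ballI)
  fix u :: 'a assume "u \<in> sphere 0 1"
  then show "norm (u + s *\<^sub>R e) \<noteq> 0" using norm_shift_bounds(1)[of u e s] assms by auto
qed

text \<open>Maximality is monotone: adding a positive multiple of \<open>e\<close> to a direction cannot decrease
  the \<open>e\<close>-component of a maximiser.\<close>

lemma support_face_mono:
  assumes "w \<in> support_face P x" "w' \<in> support_face P (x + r *\<^sub>R e)" "0 < r"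
  shows "w \<bullet> e \<le> w' \<bullet> e"
proof -
  have "w' \<bullet> x \<le> w \<bullet> x" "w \<bullet> (x + r *\<^sub>R e) \<le> w' \<bullet> (x + r *\<^sub>R e)"
    using assms by (auto simp: support_face_def)
  then have "r * (w \<bullet> e) \<le> r * (w' \<bullet> e)" by (simp add: inner_add_right)
  then show ?thesis using \<open>0 < r\<close> by simp
qed

lemma support_face_scaleR:
  "0 < c \<Longrightarrow> support_face P (c *\<^sub>R u) = support_face P u"
  by (auto simp: support_face_def)

text \<open>The directions whose support face is at least as long, measured along \<open>e\<close>, as the gap from \<open>q\<close>
  to \<open>q'\<close>. Prescribing the gap keeps the set compact. The directions with several maximisers are
  covered by these sets with \<open>e\<close> in the basis and rational \<open>q < q'\<close>.\<close>

definition kinked_directions :: "'a::euclidean_space set \<Rightarrow> 'a \<Rightarrow> real \<Rightarrow> real \<Rightarrow> 'a set" where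
  "kinked_directions P e q q' =
     {u \<in> sphere 0 1. \<exists>w\<in>support_face P u. \<exists>w'\<in>support_face P u. w \<bullet> e \<le> q \<and> q' \<le> w' \<bullet> e}"

lemma compact_kinked_directions:
  assumes "compact P"
  shows "compact (kinked_directions P e q q')"
proof -
  let ?F = "(\<Inter>p\<in>P. {x. p \<bullet> fst x \<le> fst (snd x) \<bullet> fst x} \<inter> {x. p \<bullet> fst x \<le> snd (snd x) \<bullet> fst x})
    \<inter> {x. fst (snd x) \<bullet> e \<le> q} \<inter> {x. q' \<le> snd (snd x) \<bullet> e}"
  have "closed ?F"
    by (intro closed_Int closed_INT ballI closed_Collect_le continuous_on_inner continuous_on_fst
        continuous_on_snd continuous_on_id continuous_on_const)
  then have "compact ((sphere 0 1 \<times> P \<times> P) \<inter> ?F)"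
    using assms by (intro compact_Int_closed compact_Times) auto
  then have "compact (fst ` ((sphere 0 1 \<times> P \<times> P) \<inter> ?F))"
    by (rule compact_continuous_image[rotated]) (intro continuous_intros)
  also have "fst ` ((sphere 0 1 \<times> P \<times> P) \<inter> ?F) = kinked_directions P e q q'"
  proof (intro set_eqI iffI)
    fix u assume "u \<in> kinked_directions P e q q'"
    then obtain w w' where "u \<in> sphere 0 1" "w \<in> support_face P u" "w' \<in> support_face P u"
      "w \<bullet> e \<le> q" "q' \<le> w' \<bullet> e"
      unfolding kinked_directions_def by blast
    then have "(u, w, w') \<in> (sphere 0 1 \<times> P \<times> P) \<inter> ?F"
      by (simp add: support_face_def)
    then show "u \<in> fst ` ((sphere 0 1 \<times> P \<times> P) \<inter> ?F)"
      by (rule image_eqI[rotated]) simp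
  next
    fix u assume "u \<in> fst ` ((sphere 0 1 \<times> P \<times> P) \<inter> ?F)"
    then obtain w w' where "(u, w, w') \<in> (sphere 0 1 \<times> P \<times> P) \<inter> ?F"
      by force
    then have "u \<in> sphere 0 1" "w \<in> support_face P u" "w' \<in> support_face P u"
      "w \<bullet> e \<le> q" "q' \<le> w' \<bullet> e"
      by (simp_all add: support_face_def)
    then show "u \<in> kinked_directions P e q q'"
      unfolding kinked_directions_def by blast
  qed
  finally show ?thesis .
qed

text \<open>If two of the shifted copies met, two points of the cone over the kinked directions would differ
  by a multiple of \<open>e\<close>. Each of the two points has maximisers on both sides of the gap, so the
  \<open>e\<close>-component could drop from at least \<open>q'\<close> at the first point to at most \<open>q\<close> at the second, against
  its monotonicity.\<close>

lemma disjoint_shifted_kinked_directions: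
  fixes P :: "'a::euclidean_space set"
  assumes e: "norm e = 1" and s: "0 \<le> s" "s < t" "t \<le> 1/4" and "q < q'"
  shows "shifted_direction s e ` kinked_directions P e q q' \<inter>
         shifted_direction t e ` kinked_directions P e q q' = {}"
proof (rule ccontr)
  assume "\<not> ?thesis"
  then obtain u v where uv: "u \<in> kinked_directions P e q q'" "v \<in> kinked_directions P e q q'"
    and eq: "shifted_direction s e u = shifted_direction t e v" by auto
  have n: "norm u = 1" "norm v = 1" using uv by (auto simp: kinked_directions_def)
  define c where "c = norm (u + s *\<^sub>R e) / norm (v + t *\<^sub>R e)"
  have pos: "0 < norm (u + s *\<^sub>R e)" "0 < norm (v + t *\<^sub>R e)"
    using norm_shift_bounds(1)[of u e s] norm_shift_bounds(1)[of v e t] n e s by auto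
  then have "0 < c" by (simp add: c_def)
  have "u + s *\<^sub>R e = norm (u + s *\<^sub>R e) *\<^sub>R shifted_direction s e u"
    using pos by (simp add: shifted_direction_def sgn_div_norm)
  also have "\<dots> = c *\<^sub>R (v + t *\<^sub>R e)"
    using pos unfolding eq by (simp add: shifted_direction_def sgn_div_norm c_def divide_inverse)
  finally have u: "u = c *\<^sub>R v + (c * t - s) *\<^sub>R e" by (simp add: algebra_simps)
  obtain w w' where w: "w \<in> support_face P u" "w' \<in> support_face P u" "w \<bullet> e \<le> q" "q' \<le> w' \<bullet> e"
    using uv(1) by (auto simp: kinked_directions_def)
  obtain z z' where z: "z \<in> support_face P v" "z' \<in> support_face P v" "z \<bullet> e \<le> q" "q' \<le> z' \<bullet> e"
    using uv(2) by (auto simp: kinked_directions_def)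
  have z': "z \<in> support_face P (c *\<^sub>R v)" "z' \<in> support_face P (c *\<^sub>R v)"
    using z \<open>0 < c\<close> by (simp_all add: support_face_scaleR)
  consider "c * t - s = 0" | "0 < c * t - s" | "0 < s - c * t" by linarith
  then show False
  proof cases
    case 1
    then have "u = c *\<^sub>R v" using u by simp
    then have "c = 1" using n \<open>0 < c\<close> by simp
    then show False using 1 s by simp
  next
    case 2
    then have "z' \<bullet> e \<le> w \<bullet> e" using support_face_mono[OF z'(2)] w(1) u by blast
    then show False using w z \<open>q < q'\<close> by simp
  next
    case 3
    have "c *\<^sub>R v = u + (s - c * t) *\<^sub>R e" using u by (simp add: algebra_simps)
    then have "w' \<bullet> e \<le> z \<bullet> e" using support_face_mono[OF w(2) _ 3] z'(1) by metis
    then show False using w z \<open>q < q'\<close> by simp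
  qed
qed

text \<open>Infinitely many disjoint copies, each with at least a fixed fraction of the measure of the
  original, do not fit into a sphere of finite measure unless the original is null.\<close>

lemma kinked_directions_null:
  fixes P :: "'a::euclidean_space set"
  assumes "compact P" and fin: "emeasure sphere_measure (sphere (0::'a) 1) < \<infinity>"
    and e: "norm e = 1" and "q < q'"
  shows "kinked_directions P e q q' \<in> null_sets sphere_measure"
proof -
  let ?N = "kinked_directions P e q q'"
  \<comment> \<open>Distinct shifts in the range where directions are contracted at most by the factor 2.\<close>
  define r :: "nat \<Rightarrow> real" where "r i = 1 / (real i + 4)" for i
  have r: "0 \<le> r i" "r i \<le> 1/4" for i by (auto simp: r_def field_simps)
  have N: "compact ?N" "?N \<subseteq> sphere 0 1"
    using compact_kinked_directions[OF \<open>compact P\<close>] by (auto simp: kinked_directions_def)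
  define T where "T i = shifted_direction (r i) e ` ?N" for i
  have T_compact: "compact (T i)" for i
    unfolding T_def
    using N continuous_on_subset[OF continuous_on_shifted_direction[OF e r, of i]]
    by (intro compact_continuous_image) auto
  have T_sphere: "T i \<subseteq> sphere 0 1" for i
  proof
    fix x assume "x \<in> T i"
    then obtain u where u: "u \<in> ?N" "x = sgn (u + r i *\<^sub>R e)"
      by (auto simp: T_def shifted_direction_def)
    then have "3/4 \<le> norm (u + r i *\<^sub>R e)" using N(2) e r by (intro norm_shift_bounds) auto
    then have "u + r i *\<^sub>R e \<noteq> 0" by auto
    then show "x \<in> sphere 0 1" by (simp add: u norm_sgn)
  qed
  have T_sets: "T i \<in> sets sphere_measure" for i
    by (intro borel_subset_in_sets_sphere_measure T_sphere borel_closed compact_imp_closed T_compact)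
  have N_sets: "?N \<in> sets sphere_measure"
    by (intro borel_subset_in_sets_sphere_measure N borel_closed compact_imp_closed)
  have "disjoint_family T"
    unfolding disjoint_family_on_def
  proof (intro ballI impI)
    fix i j :: nat assume "i \<noteq> j"
    then have "r i < r j \<or> r j < r i" by (auto simp: r_def field_simps)
    then show "T i \<inter> T j = {}"
      unfolding T_def using disjoint_shifted_kinked_directions[OF e r(1) _ r(2) \<open>q < q'\<close>]
      by (metis inf_commute)
  qed
  then have sum: "(\<Sum>i. emeasure sphere_measure (T i)) = emeasure sphere_measure (\<Union>i. T i)"
    using T_sets by (intro suminf_emeasure) auto
  have "emeasure sphere_measure (\<Union>i. T i) \<le> emeasure sphere_measure (sphere (0::'a) 1)"
    using T_sphere by (intro emeasure_mono borel_subset_in_sets_sphere_measure) auto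
  with fin sum have sum_fin: "(\<Sum>i. emeasure sphere_measure (T i)) < \<infinity>" by simp
  \<comment> \<open>\<open>inv_into\<close> undoes the shift and at most doubles distances.\<close>
  have le: "emeasure sphere_measure ?N \<le> ennreal (2 ^ (DIM('a) - 1)) * emeasure sphere_measure (T i)" for i
  proof -
    have exp: "dist u v \<le> 2 * dist (shifted_direction (r i) e u) (shifted_direction (r i) e v)"
      if "u \<in> ?N" "v \<in> ?N" for u v
      using that N(2) e r by (intro dist_le_shifted_direction) auto
    have inj: "inj_on (shifted_direction (r i) e) ?N"
    proof (rule inj_onI)
      fix u v assume "u \<in> ?N" "v \<in> ?N" "shifted_direction (r i) e u = shifted_direction (r i) e v"
      then show "u = v" using exp[of u v] by simp
    qed
    let ?p = "inv_into ?N (shifted_direction (r i) e)"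
    have pT: "?p ` T i = ?N" unfolding T_def using inj by (simp add: inv_into_image_cancel)
    have "emeasure sphere_measure (?p ` T i) \<le> ennreal (2 ^ (DIM('a) - 1)) * emeasure sphere_measure (T i)"
    proof (rule emeasure_sphere_measure_lipschitz_image)
      show "dist (?p x) (?p y) \<le> 2 * dist x y" if "x \<in> T i" "y \<in> T i" for x y
      proof -
        obtain u v where uv: "u \<in> ?N" "v \<in> ?N"
          "x = shifted_direction (r i) e u" "y = shifted_direction (r i) e v"
          using \<open>x \<in> T i\<close> \<open>y \<in> T i\<close> unfolding T_def by blast
        show ?thesis
          unfolding uv(3,4) inv_into_f_f[OF inj uv(1)] inv_into_f_f[OF inj uv(2)]
          by (rule exp[OF uv(1,2)])
      qed
      show "T i \<in> sets borel" "T i \<subseteq> sphere 0 1"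
        by (intro borel_closed compact_imp_closed T_compact T_sphere)+
      show "?p ` T i \<in> sets borel" "?p ` T i \<subseteq> sphere 0 1"
        unfolding pT by (intro borel_closed compact_imp_closed N)+
    qed simp
    then show ?thesis by (simp only: pT)
  qed
  have "emeasure sphere_measure ?N = 0"
  proof (rule ccontr)
    assume "emeasure sphere_measure ?N \<noteq> 0"
    define d where "d = emeasure sphere_measure ?N / ennreal (2 ^ (DIM('a) - 1))"
    have "d \<noteq> 0"
      using \<open>emeasure sphere_measure ?N \<noteq> 0\<close> by (auto simp: d_def ennreal_divide_eq_0_iff)
    have "d \<le> emeasure sphere_measure (T i)" for i
      unfolding d_def using le[of i]
      by (subst ennreal_divide_le_iff) auto
    then have "(\<Sum>i::nat. d) \<le> (\<Sum>i. emeasure sphere_measure (T i))"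
      by (intro suminf_le) auto
    moreover have "(\<Sum>i::nat. d) = \<infinity>"
      using \<open>d \<noteq> 0\<close> nn_integral_count_space_nat[of "\<lambda>_. d"]
      by (simp add: ennreal_mult_eq_top_iff)
    ultimately show False using sum_fin by (simp add: top_unique)
  qed
  then show ?thesis using N_sets by auto
qed

text \<open>The support function of \<open>P\<close> is differentiable at \<open>u\<close> exactly if the support face is a single
  point. This is therefore the almost everywhere differentiability of that convex function, with
  respect to the measure on the sphere.\<close>

lemma almost_every_support_face_unique:
  fixes P :: "'a::euclidean_space set"
  assumes "compact P" and fin: "emeasure sphere_measure (sphere (0::'a) 1) < \<infinity>"
  shows "{u \<in> sphere 0 1. \<exists>w\<in>support_face P u. \<exists>w'\<in>support_face P u. w \<noteq> w'}
    \<in> null_sets sphere_measure" (is "?S \<in> _")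
proof -
  let ?Q = "{(q, q'). q \<in> \<rat> \<and> q' \<in> \<rat> \<and> q < q'} :: (real \<times> real) set"
  have "countable (\<rat> \<times> \<rat> :: (real \<times> real) set)"
    by (intro countable_SIGMA countable_rat)
  then have Q: "countable ?Q" by (rule countable_subset[rotated]) auto
  then have null: "(\<Union>e\<in>Basis. \<Union>x\<in>?Q. kinked_directions P e (fst x) (snd x)) \<in> null_sets sphere_measure"
  proof (intro null_sets_UN')
    show "countable (Basis :: 'a set)" by (simp add: countable_finite)
    show "countable ?Q" by (rule Q)
    show "kinked_directions P e (fst x) (snd x) \<in> null_sets sphere_measure"
      if "e \<in> Basis" "x \<in> ?Q" for e :: 'a and x
      using that by (intro kinked_directions_null assms) auto
  qed
  show ?thesis
  proof (rule null_subset_sphere_measure[OF null], rule subsetI)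
    fix u assume "u \<in> ?S"
    then obtain w w' where u: "u \<in> sphere 0 1" and w: "w \<in> support_face P u" "w' \<in> support_face P u"
      and "w \<noteq> w'" by auto
    then obtain e where e: "e \<in> Basis" "w \<bullet> e \<noteq> w' \<bullet> e" by (auto simp: euclidean_eq_iff[of w])
    have key: "u \<in> (\<Union>x\<in>?Q. kinked_directions P e (fst x) (snd x))"
      if lt: "x \<bullet> e < y \<bullet> e" and xy: "x \<in> support_face P u" "y \<in> support_face P u" for x y
    proof -
      obtain q where q: "q \<in> \<rat>" "x \<bullet> e < q" "q < y \<bullet> e" using Rats_dense_in_real[OF lt] by auto
      obtain q' where q': "q' \<in> \<rat>" "q < q'" "q' < y \<bullet> e" using Rats_dense_in_real[OF q(3)] by auto
      have "u \<in> kinked_directions P e q q'"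
        using u xy q q' unfolding kinked_directions_def mem_Collect_eq
        by (intro conjI bexI[of _ x] bexI[of _ y]) auto
      then have "u \<in> kinked_directions P e (fst (q, q')) (snd (q, q'))" by simp
      moreover have "(q, q') \<in> ?Q" using q q' by simp
      ultimately show ?thesis by blast
    qed
    have "w \<bullet> e < w' \<bullet> e \<or> w' \<bullet> e < w \<bullet> e" using e(2) by linarith
    then have "u \<in> (\<Union>x\<in>?Q. kinked_directions P e (fst x) (snd x))"
      using key w by blast
    with e(1) show "u \<in> (\<Union>e\<in>Basis. \<Union>x\<in>?Q. kinked_directions P e (fst x) (snd x))"
      by blast
  qed
qed

section \<open>Support functions, radial functions and Wulff shapes\<close>

lemma sphere_nonempty: "sphere (0::'a::euclidean_space) 1 \<noteq> {}"
proof -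
  have "(SOME i. i \<in> Basis) \<in> sphere (0::'a) 1" by (simp add: SOME_Basis)
  then show ?thesis by blast
qed

lemma continuous_on_sphere_bounded:
  fixes g :: "'a::euclidean_space \<Rightarrow> real"
  assumes "continuous_on (sphere 0 1) g"
  obtains B where "\<And>v. v \<in> sphere 0 1 \<Longrightarrow> \<bar>g v\<bar> \<le> B"
proof -
  have "bounded (g ` sphere 0 1)"
    by (intro compact_imp_bounded compact_continuous_image assms compact_sphere)
  then obtain B where "\<forall>v\<in>sphere 0 1. \<bar>g v\<bar> \<le> B" by (auto simp: bounded_iff)
  then show thesis using that by blast
qed

lemma inner_le_support_fun:
  assumes "compact K" "x \<in> K"
  shows "x \<bullet> v \<le> support_fun K v"
proof -
  have "compact ((\<bullet>) v ` K)"
    by (intro compact_continuous_image assms continuous_intros)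
  then have "bdd_above ((\<bullet>) v ` K)" by (intro bounded_imp_bdd_above compact_imp_bounded)
  then show ?thesis
    unfolding support_fun_def inner_commute[of x v] by (intro cSUP_upper assms)
qed

lemma support_fun_le:
  "K \<noteq> {} \<Longrightarrow> (\<And>x. x \<in> K \<Longrightarrow> x \<bullet> v \<le> b) \<Longrightarrow> support_fun K v \<le> b"
  unfolding support_fun_def by (intro cSUP_least) (auto simp: inner_commute)

lemma support_fun_diff_le:
  assumes K: "compact K" "K \<noteq> {}" "K \<subseteq> cball 0 R"
  shows "support_fun K u - support_fun K v \<le> R * norm (u - v)"
proof -
  have "support_fun K u \<le> support_fun K v + R * norm (u - v)"
  proof (rule support_fun_le[OF K(2)])
    fix x assume x: "x \<in> K"
    have "x \<bullet> u = x \<bullet> v + x \<bullet> (u - v)" by (simp add: inner_diff_right)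
    also have "x \<bullet> (u - v) \<le> norm x * norm (u - v)" by (rule norm_cauchy_schwarz)
    also have "\<dots> \<le> R * norm (u - v)" using x K(3) by (intro mult_right_mono) auto
    finally show "x \<bullet> u \<le> support_fun K v + R * norm (u - v)"
      using inner_le_support_fun[OF K(1) x, of v] by linarith
  qed
  then show ?thesis by simp
qed

lemma convex_body_bounds:
  assumes "K \<in> convex_bodies_o"
  obtains r R where "0 < r" "0 < R" "cball 0 r \<subseteq> K" "K \<subseteq> cball 0 R"
proof -
  obtain r where r: "0 < r" "cball 0 r \<subseteq> interior K"
    using assms open_contains_cball[of "interior K"] by (auto simp: convex_bodies_o_def)
  obtain R where "0 < R" "K \<subseteq> cball 0 R"
    using assms bounded_subset_ballD[of K 0] ball_subset_cball
    unfolding convex_bodies_o_def by (blast dest: compact_imp_bounded)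
  then show ?thesis using that r interior_subset[of K] by blast
qed

lemma convex_bodyD:
  assumes "K \<in> convex_bodies_o"
  shows "compact K" "convex K" "closed K" "K \<noteq> {}" "0 \<in> K"
  using assms interior_subset[of K] by (auto simp: convex_bodies_o_def compact_imp_closed)

lemma support_fun_ge:
  assumes "compact K" "cball 0 r \<subseteq> K" "0 \<le> r" "norm v = 1"
  shows "r \<le> support_fun K v"
proof -
  have "r *\<^sub>R v \<in> K" using assms by auto
  from inner_le_support_fun[OF assms(1) this, of v] show ?thesis
    using assms(4) by (simp add: norm_eq_1)
qed

lemma support_fun_upper:
  assumes "K \<noteq> {}" "K \<subseteq> cball 0 R" "norm v = 1"
  shows "support_fun K v \<le> R"
proof (rule support_fun_le)
  fix x assume "x \<in> K"
  then have "norm x \<le> R" using assms by auto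
  then show "x \<bullet> v \<le> R" using norm_cauchy_schwarz[of x v] assms by simp
qed fact

lemma support_fun_pos:
  assumes "K \<in> convex_bodies_o" "v \<in> sphere 0 1"
  shows "0 < support_fun K v"
proof -
  obtain r R where "0 < r" "cball 0 r \<subseteq> K" by (rule convex_body_bounds[OF assms(1)])
  then show ?thesis
    using support_fun_ge[OF convex_bodyD(1)[OF assms(1)], of r v] assms(2) by simp
qed

lemma continuous_on_support_fun:
  assumes "K \<in> convex_bodies_o"
  shows "continuous_on A (support_fun K)"
proof -
  obtain r R where R: "0 < R" "K \<subseteq> cball 0 R" by (rule convex_body_bounds[OF assms])
  have "R-lipschitz_on A (support_fun K)"
  proof (rule lipschitz_onI)
    fix u v
    have "support_fun K u - support_fun K v \<le> R * norm (u - v)"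
      "support_fun K v - support_fun K u \<le> R * norm (v - u)"
      by (intro support_fun_diff_le convex_bodyD[OF assms] R)+
    then show "dist (support_fun K u) (support_fun K v) \<le> R * dist u v"
      by (simp add: dist_norm norm_minus_commute abs_le_iff)
  qed (use R in simp)
  then show ?thesis by (rule lipschitz_on_continuous_on)
qed

definition wulff_shape :: "('a::euclidean_space \<Rightarrow> real) \<Rightarrow> 'a set" where
  "wulff_shape f = {x. \<forall>v\<in>sphere 0 1. x \<bullet> v \<le> f v}"

lemma wulff_shape_support_fun:
  assumes "K \<in> convex_bodies_o"
  shows "wulff_shape (support_fun K) = K"
proof (intro equalityI subsetI)
  fix x assume x: "x \<in> wulff_shape (support_fun K)"
  note K = convex_bodyD[OF assms]
  show "x \<in> K"
  proof (rule ccontr)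
    assume "x \<notin> K"
    then obtain a b where ab: "a \<bullet> x < b" "\<And>y. y \<in> K \<Longrightarrow> b < a \<bullet> y"
      using separating_hyperplane_closed_point[OF K(2,3)] by metis
    have "a \<noteq> 0" using ab ab(2)[OF K(5)] by auto
    define v where "v = - sgn a"
    have v: "y \<bullet> v = - (a \<bullet> y) / norm a" for y
      by (simp add: v_def sgn_div_norm inner_commute divide_inverse)
    have "support_fun K v \<le> - b / norm a"
      using ab(2) \<open>a \<noteq> 0\<close> unfolding v by (intro support_fun_le K, unfold v)
        (auto simp: field_simps intro: less_imp_le)
    also have "\<dots> < x \<bullet> v" using ab(1) \<open>a \<noteq> 0\<close> unfolding v by (simp add: divide_strict_right_mono)
    finally have "support_fun K v < x \<bullet> v" .
    moreover have "v \<in> sphere 0 1" using \<open>a \<noteq> 0\<close> by (simp add: v_def norm_sgn)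
    moreover have "x \<bullet> v \<le> support_fun K v"
      using x \<open>v \<in> sphere 0 1\<close> unfolding wulff_shape_def by blast
    ultimately show False by linarith
  qed
qed (auto simp: wulff_shape_def inner_le_support_fun convex_bodyD[OF assms])

lemma wulff_shape_convex_body:
  assumes f: "continuous_on (sphere 0 1) f" "\<And>v. v \<in> sphere 0 1 \<Longrightarrow> 0 < f v"
  shows "wulff_shape f \<in> convex_bodies_o"
proof -
  have eq: "wulff_shape f = (\<Inter>v\<in>sphere 0 1. {x. v \<bullet> x \<le> f v})"
    by (auto simp: wulff_shape_def inner_commute)
  have cl: "closed (wulff_shape f)" "convex (wulff_shape f)"
    unfolding eq by (auto intro!: closed_INT convex_INT closed_halfspace_le convex_halfspace_le)
  obtain v where v: "v \<in> sphere 0 1" "\<And>w. w \<in> sphere 0 1 \<Longrightarrow> f w \<le> f v"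
    using continuous_attains_sup[OF compact_sphere sphere_nonempty f(1)] by blast
  have "norm x \<le> f v" if x: "x \<in> wulff_shape f" for x
  proof (cases "x = 0")
    case True then show ?thesis using f(2)[OF v(1)] by simp
  next
    case False
    then have "x \<bullet> sgn x = norm x"
      by (simp add: sgn_div_norm flip: power2_norm_eq_inner) (simp add: power2_eq_square)
    moreover have "sgn x \<in> sphere 0 1" using False by (simp add: norm_sgn)
    ultimately show ?thesis using x v(2)[of "sgn x"] by (force simp: wulff_shape_def)
  qed
  then have "bounded (wulff_shape f)" by (auto simp: bounded_iff)
  obtain w where w: "w \<in> sphere 0 1" "\<And>v. v \<in> sphere 0 1 \<Longrightarrow> f w \<le> f v"
    using continuous_attains_inf[OF compact_sphere sphere_nonempty f(1)] by blast
  have "cball 0 (f w) \<subseteq> wulff_shape f"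
  proof
    fix x :: 'a assume x: "x \<in> cball 0 (f w)"
    show "x \<in> wulff_shape f"
      unfolding wulff_shape_def
    proof (intro CollectI ballI)
      fix v :: 'a assume "v \<in> sphere 0 1"
      then show "x \<bullet> v \<le> f v"
        using norm_cauchy_schwarz[of x v] w(2)[of v] x by simp
    qed
  qed
  then have "0 \<in> interior (wulff_shape f)"
    using f(2)[OF w(1)] by (intro interiorI[of "ball 0 (f w)"]) auto
  then show ?thesis
    using cl \<open>bounded (wulff_shape f)\<close> by (auto simp: convex_bodies_o_def compact_eq_bounded_closed)
qed

lemma support_fun_wulff_shape_le:
  assumes "wulff_shape f \<in> convex_bodies_o" "v \<in> sphere 0 1"
  shows "support_fun (wulff_shape f) v \<le> f v"
  using assms(2) by (intro support_fun_le convex_bodyD[OF assms(1)]) (auto simp: wulff_shape_def)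

lemma
  assumes K: "K \<in> convex_bodies_o" and u: "u \<in> sphere 0 1"
  shows radial_fun_pos: "0 < radial_fun K u"
    and radial_fun_mem: "radial_fun K u *\<^sub>R u \<in> K"
    and radial_fun_greatest: "\<And>s. s *\<^sub>R u \<in> K \<Longrightarrow> s \<le> radial_fun K u"
proof -
  obtain r R where r: "0 < r" "cball 0 r \<subseteq> K" and R: "K \<subseteq> cball 0 R"
    by (rule convex_body_bounds[OF K])
  let ?A = "{r. 0 < r \<and> r *\<^sub>R u \<in> K}"
  have rA: "r \<in> ?A" using r u by auto
  have "s \<le> R" if "s \<in> ?A" for s
  proof -
    have "s *\<^sub>R u \<in> cball 0 R" using that R by blast
    then show ?thesis using u by simp
  qed
  then have bdd: "bdd_above ?A" by (auto simp: bdd_above_def)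
  have up: "s \<le> radial_fun K u" if "s \<in> ?A" for s
    unfolding radial_fun_def by (intro cSup_upper that bdd)
  show pos: "0 < radial_fun K u" using up[OF rA] r by simp
  have "closed {r. r *\<^sub>R u \<in> K}"
    using continuous_closed_vimage[OF convex_bodyD(3)[OF K], of "\<lambda>r. r *\<^sub>R u"]
    by (simp add: vimage_def continuous_intros)
  then have "closure ?A \<subseteq> {r. r *\<^sub>R u \<in> K}" by (intro closure_minimal) auto
  moreover have "Sup ?A \<in> closure ?A"
    using rA bdd by (intro closure_contains_Sup) auto
  ultimately show "radial_fun K u *\<^sub>R u \<in> K" unfolding radial_fun_def by blast
  show "s \<le> radial_fun K u" if "s *\<^sub>R u \<in> K" for s
    using up[of s] pos that by (cases "0 < s") auto
qed

lemma radial_fun_inner_le: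
  assumes "K \<in> convex_bodies_o" "u \<in> sphere 0 1"
  shows "radial_fun K u * (u \<bullet> v) \<le> support_fun K v"
  using inner_le_support_fun[OF convex_bodyD(1)[OF assms(1)] radial_fun_mem[OF assms], of v] by simp

text \<open>The radial function of a Wulff shape is the minimum of \<open>f v / (u \<bullet> v)\<close> over the \<open>v\<close> with
  \<open>0 < u \<bullet> v\<close>. The active constraint is found by maximising \<open>u \<bullet> v / f v\<close>, which is continuous on
  the whole sphere.\<close>

lemma radial_fun_wulff_shape_attained:
  fixes f :: "'a::euclidean_space \<Rightarrow> real"
  assumes f: "continuous_on (sphere 0 1) f" "\<And>v. v \<in> sphere 0 1 \<Longrightarrow> 0 < f v"
    and u: "u \<in> sphere 0 1"
  shows "\<exists>v\<in>sphere 0 1. radial_fun (wulff_shape f) u * (u \<bullet> v) = f v"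
proof -
  have K: "wulff_shape f \<in> convex_bodies_o" by (rule wulff_shape_convex_body) fact+
  have "continuous_on (sphere 0 1) (\<lambda>v. u \<bullet> v / f v)"
    using f by (intro continuous_intros) force+
  then obtain v where v: "v \<in> sphere 0 1" "\<And>w. w \<in> sphere 0 1 \<Longrightarrow> u \<bullet> w / f w \<le> u \<bullet> v / f v"
    using continuous_attains_sup[OF compact_sphere sphere_nonempty, of "\<lambda>v. u \<bullet> v / f v"] by blast
  define m where "m = u \<bullet> v / f v"
  have "0 < u \<bullet> u / f u" using f(2)[OF u] u by (auto simp: norm_eq_1)
  then have "0 < m" using v(2)[OF u] by (simp add: m_def)
  have "(1 / m) *\<^sub>R u \<in> wulff_shape f"
    using v(2) f(2) \<open>0 < m\<close> by (auto simp: wulff_shape_def field_simps simp flip: m_def)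
  then have "1 / m \<le> radial_fun (wulff_shape f) u" by (rule radial_fun_greatest[OF K u])
  then have "f v \<le> radial_fun (wulff_shape f) u * (u \<bullet> v)"
    using \<open>0 < m\<close> f(2)[OF v(1)] by (simp add: m_def field_simps zero_less_divide_iff)
  moreover have "radial_fun (wulff_shape f) u * (u \<bullet> v) \<le> f v"
    using radial_fun_mem[OF K u] v(1) by (force simp: wulff_shape_def)
  ultimately show ?thesis using v(1) by force
qed

section \<open>Outer normals\<close>

text \<open>Equality in \<open>radial_fun_inner_le\<close>: the vector \<open>v\<close> is an outer normal at the boundary point in
  direction \<open>u\<close>.\<close>

definition touching_normal :: "'a::euclidean_space set \<Rightarrow> 'a \<Rightarrow> 'a \<Rightarrow> bool" where
  "touching_normal K u v \<longleftrightarrow> v \<in> sphere 0 1 \<and> radial_fun K u * (u \<bullet> v) = support_fun K v"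

lemma touching_normal_exists:
  assumes "K \<in> convex_bodies_o" "u \<in> sphere 0 1"
  shows "\<exists>v. touching_normal K u v"
  using radial_fun_wulff_shape_attained[OF continuous_on_support_fun[OF assms(1)]
      support_fun_pos[OF assms(1)] assms(2)]
  by (auto simp: touching_normal_def wulff_shape_support_fun[OF assms(1)])

lemma outer_unit_normal_iff:
  assumes "K \<in> convex_bodies_o" "u \<in> sphere 0 1"
  shows "outer_unit_normal K (radial_fun K u *\<^sub>R u) v \<longleftrightarrow> touching_normal K u v"
proof (cases "v \<in> sphere 0 1")
  case True
  have "(\<forall>y\<in>K. (y - radial_fun K u *\<^sub>R u) \<bullet> v \<le> 0) \<longleftrightarrow> support_fun K v \<le> radial_fun K u * (u \<bullet> v)"
    (is "?L \<longleftrightarrow> ?R")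
  proof
    assume ?L
    then show ?R by (intro support_fun_le convex_bodyD[OF assms(1)]) (auto simp: inner_diff_left)
  next
    assume ?R
    then show ?L
      using inner_le_support_fun[OF convex_bodyD(1)[OF assms(1)], of _ v]
      by (force simp: inner_diff_left)
  qed
  then show ?thesis
    using True radial_fun_inner_le[OF assms, of v]
    by (auto simp: outer_unit_normal_def touching_normal_def)
qed (auto simp: outer_unit_normal_def touching_normal_def)

lemma inverse_radial_fun_diff_le:
  assumes K: "K \<in> convex_bodies_o" and r: "0 < r" "cball 0 r \<subseteq> K"
    and u: "u \<in> sphere 0 1" "u' \<in> sphere 0 1"
  shows "1 / radial_fun K u - 1 / radial_fun K u' \<le> 1 / r * norm (u - u')"
proof -
  obtain v where v: "v \<in> sphere 0 1" "radial_fun K u * (u \<bullet> v) = support_fun K v"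
    using touching_normal_exists[OF K u(1)] by (auto simp: touching_normal_def)
  have h: "r \<le> support_fun K v"
    using v(1) r by (intro support_fun_ge convex_bodyD[OF K]) auto
  have pos: "0 < radial_fun K u" "0 < radial_fun K u'" by (intro radial_fun_pos K u)+
  have "1 / radial_fun K u = u \<bullet> v / support_fun K v"
    using pos h r v(2) by (auto simp: field_simps)
  also have "\<dots> = u' \<bullet> v / support_fun K v + (u - u') \<bullet> v / support_fun K v"
    by (simp add: inner_diff_left diff_divide_distrib)
  also have "u' \<bullet> v / support_fun K v \<le> 1 / radial_fun K u'"
    using radial_fun_inner_le[OF K u(2), of v] pos h r by (simp add: field_simps)
  also have "(u - u') \<bullet> v / support_fun K v \<le> norm (u - u') / r"
    using norm_cauchy_schwarz[of "u - u'" v] v(1) h r by (intro frac_le) auto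
  finally show ?thesis by simp
qed

lemma continuous_on_radial_fun:
  assumes K: "K \<in> convex_bodies_o"
  shows "continuous_on (sphere 0 1) (radial_fun K)"
proof -
  obtain r R where r: "0 < r" "cball 0 r \<subseteq> K" by (rule convex_body_bounds[OF K])
  have "(1 / r)-lipschitz_on (sphere 0 1) (\<lambda>u. 1 / radial_fun K u)"
  proof (rule lipschitz_onI)
    fix u v :: 'a assume "u \<in> sphere 0 1" "v \<in> sphere 0 1"
    then have "1 / radial_fun K u - 1 / radial_fun K v \<le> 1 / r * norm (u - v)"
      "1 / radial_fun K v - 1 / radial_fun K u \<le> 1 / r * norm (v - u)"
      using inverse_radial_fun_diff_le[OF K r] by blast+
    then show "dist (1 / radial_fun K u) (1 / radial_fun K v) \<le> 1 / r * dist u v"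
      unfolding dist_norm real_norm_def norm_minus_commute[of v u] by linarith
  qed (use r in simp)
  then have "continuous_on (sphere 0 1) (\<lambda>u. 1 / radial_fun K u)"
    by (rule lipschitz_on_continuous_on)
  moreover have "\<forall>u\<in>sphere 0 1. 1 / radial_fun K u \<noteq> 0"
  proof
    fix u :: 'a assume "u \<in> sphere 0 1"
    then show "1 / radial_fun K u \<noteq> 0" using radial_fun_pos[OF K, of u] by simp
  qed
  ultimately have "continuous_on (sphere 0 1) (\<lambda>u. 1 / (1 / radial_fun K u))"
    by (rule continuous_on_divide[OF continuous_on_const])
  then show ?thesis by simp
qed

definition singular_directions :: "'a::euclidean_space set \<Rightarrow> 'a set" where
  "singular_directions K =
     {u \<in> sphere 0 1. \<exists>v v'. touching_normal K u v \<and> touching_normal K u v' \<and> v \<noteq> v'}"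

text \<open>After division by the support function, the normals at \<open>u\<close> become maximisers of \<open>w \<bullet> u\<close> over the
  compact set of all \<open>v /\<^sub>R support_fun K v\<close>, with maximum \<open>1 / radial_fun K u\<close>. A normal can be
  recovered from its quotient, so distinct normals give distinct maximisers.\<close>

lemma singular_directions_null:
  fixes K :: "'a::euclidean_space set"
  assumes K: "K \<in> convex_bodies_o" and fin: "emeasure sphere_measure (sphere (0::'a) 1) < \<infinity>"
  shows "singular_directions K \<in> null_sets sphere_measure"
proof -
  define q where "q v = v /\<^sub>R support_fun K v" for v
  have pos: "0 < support_fun K v" if "v \<in> sphere 0 1" for v using support_fun_pos[OF K that] .
  have "compact (q ` sphere 0 1)"
    unfolding q_def using pos
    by (intro compact_continuous_image continuous_intros continuous_on_support_fun[OF K]) force+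
  moreover have "singular_directions K \<subseteq>
    {u \<in> sphere 0 1. \<exists>w\<in>support_face (q ` sphere 0 1) u. \<exists>w'\<in>support_face (q ` sphere 0 1) u. w \<noteq> w'}"
  proof
    fix u assume "u \<in> singular_directions K"
    then obtain v v' where u: "u \<in> sphere 0 1" and v: "touching_normal K u v" "touching_normal K u v'"
      and "v \<noteq> v'" by (auto simp: singular_directions_def)
    have rho: "0 < radial_fun K u" by (rule radial_fun_pos[OF K u])
    have face: "q z \<in> support_face (q ` sphere 0 1) u" if z: "touching_normal K u z" for z
    proof -
      have zs: "z \<in> sphere 0 1" "radial_fun K u * (u \<bullet> z) = support_fun K z"
        using z by (auto simp: touching_normal_def)
      have "q z \<bullet> u = 1 / radial_fun K u"
        using zs rho pos[OF zs(1)] by (simp add: q_def field_simps inner_commute)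
      moreover have "q y \<bullet> u \<le> 1 / radial_fun K u" if "y \<in> sphere 0 1" for y
        using radial_fun_inner_le[OF K u, of y] rho pos[OF that]
        by (simp add: q_def field_simps inner_commute)
      ultimately show ?thesis using zs(1) by (auto simp: support_face_def)
    qed
    have "q v \<noteq> q v'"
    proof
      assume eq: "q v = q v'"
      have n: "norm v = 1" "norm v' = 1" "0 < support_fun K v" "0 < support_fun K v'"
        using v pos by (auto simp: touching_normal_def)
      from arg_cong[OF eq, of norm] n have "support_fun K v = support_fun K v'"
        by (simp add: q_def)
      with eq n have "v = v'" by (simp add: q_def)
      with \<open>v \<noteq> v'\<close> show False ..
    qed
    then show "u \<in> {u \<in> sphere 0 1.
      \<exists>w\<in>support_face (q ` sphere 0 1) u. \<exists>w'\<in>support_face (q ` sphere 0 1) u. w \<noteq> w'}"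
      using u by (intro CollectI conjI bexI[of _ "q v"] bexI[of _ "q v'"] face v)
  qed
  ultimately show ?thesis
    by (intro null_subset_sphere_measure[OF almost_every_support_face_unique[OF _ fin]])
qed

text \<open>In a singular direction the definite description in \<open>radial_gauss_map\<close> has no specified value; a
  choice among the normals stays on the sphere, where support functions are positive.\<close>

definition normal_choice :: "'a::euclidean_space set \<Rightarrow> 'a \<Rightarrow> 'a" where
  "normal_choice K u = (SOME v. touching_normal K u v)"

lemma normal_choice_touching:
  assumes "K \<in> convex_bodies_o" "u \<in> sphere 0 1"
  shows "touching_normal K u (normal_choice K u)"
  unfolding normal_choice_def using touching_normal_exists[OF assms] by (rule someI_ex)

lemma normal_choice_in_sphere:
  "K \<in> convex_bodies_o \<Longrightarrow> u \<in> sphere 0 1 \<Longrightarrow> normal_choice K u \<in> sphere 0 1"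
  using normal_choice_touching by (auto simp: touching_normal_def)

lemma touching_normal_unique:
  assumes "K \<in> convex_bodies_o" "u \<in> sphere 0 1" "u \<notin> singular_directions K" "touching_normal K u v"
  shows "v = normal_choice K u"
  using assms normal_choice_touching[OF assms(1,2)] by (auto simp: singular_directions_def)

lemma radial_gauss_map_eq_normal_choice:
  assumes "K \<in> convex_bodies_o" "u \<in> sphere 0 1" "u \<notin> singular_directions K"
  shows "radial_gauss_map K u = normal_choice K u"
  unfolding radial_gauss_map_def outer_unit_normal_iff[OF assms(1,2)]
proof (rule the_equality)
  show "touching_normal K u (normal_choice K u)" by (rule normal_choice_touching[OF assms(1,2)])
  show "v = normal_choice K u" if "touching_normal K u v" for v
    by (rule touching_normal_unique[OF assms that])
qed

lemma compact_touching_directions: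
  assumes K: "K \<in> convex_bodies_o" and "closed C"
  shows "compact {u \<in> sphere 0 1. \<exists>v\<in>C. touching_normal K u v}"
proof -
  have "closedin (top_of_set (sphere 0 1 \<times> (C \<inter> sphere 0 1)))
      {x \<in> sphere 0 1 \<times> (C \<inter> sphere 0 1). radial_fun K (fst x) * (fst x \<bullet> snd x) - support_fun K (snd x) = 0}"
    by (intro continuous_closedin_preimage_constant continuous_intros
        continuous_on_compose2[OF continuous_on_radial_fun[OF K]]
        continuous_on_compose2[OF continuous_on_support_fun[OF K]]) auto
  then have "compact {x \<in> sphere 0 1 \<times> (C \<inter> sphere 0 1).
      radial_fun K (fst x) * (fst x \<bullet> snd x) - support_fun K (snd x) = 0}" (is "compact ?X")
    by (rule closedin_compact[rotated])
      (intro compact_Times compact_sphere closed_Int_compact \<open>closed C\<close>)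
  then have "compact (fst ` ?X)"
    by (rule compact_continuous_image[rotated]) (intro continuous_intros)
  also have "fst ` ?X = {u \<in> sphere 0 1. \<exists>v\<in>C. touching_normal K u v}"
  proof (intro set_eqI iffI)
    fix u assume "u \<in> {u \<in> sphere 0 1. \<exists>v\<in>C. touching_normal K u v}"
    then obtain v where "(u, v) \<in> ?X" by (auto simp: touching_normal_def)
    then show "u \<in> fst ` ?X" by (rule image_eqI[rotated]) simp
  qed (auto simp: touching_normal_def)
  finally show ?thesis .
qed

text \<open>Up to a subset of the null set of singular directions, the preimage of a closed set is compact.\<close>

lemma measurable_normal_choice:
  fixes K :: "'a::euclidean_space set"
  assumes K: "K \<in> convex_bodies_o" and fin: "emeasure sphere_measure (sphere (0::'a) 1) < \<infinity>"
  shows "normal_choice K \<in> borel_measurable sphere_measure"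
  unfolding borel_eq_closed
proof (rule measurable_measure_of)
  fix C :: "'a set" assume "C \<in> Collect closed"
  then have "closed C" by simp
  let ?T = "{u \<in> sphere 0 1. \<exists>v\<in>C. touching_normal K u v}" and ?N = "singular_directions K"
  have "normal_choice K -` C \<inter> space sphere_measure
      = (?T - ?N) \<union> (normal_choice K -` C \<inter> sphere 0 1 \<inter> ?N)"
    unfolding space_sphere_measure
  proof (intro equalityI subsetI)
    fix u assume "u \<in> normal_choice K -` C \<inter> sphere 0 1"
    then show "u \<in> (?T - ?N) \<union> (normal_choice K -` C \<inter> sphere 0 1 \<inter> ?N)"
      using normal_choice_touching[OF K, of u] by auto
  next
    fix u assume "u \<in> (?T - ?N) \<union> (normal_choice K -` C \<inter> sphere 0 1 \<inter> ?N)"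
    then show "u \<in> normal_choice K -` C \<inter> sphere 0 1"
      using touching_normal_unique[OF K, of u] by auto
  qed
  moreover have "normal_choice K -` C \<inter> sphere 0 1 \<inter> ?N \<in> null_sets sphere_measure"
    by (rule null_subset_sphere_measure[OF singular_directions_null[OF K fin]]) auto
  moreover have "?T \<in> sets sphere_measure"
    by (intro borel_subset_in_sets_sphere_measure borel_closed compact_imp_closed
        compact_touching_directions[OF K \<open>closed C\<close>]) auto
  ultimately show "normal_choice K -` C \<inter> space sphere_measure \<in> sets sphere_measure"
    using sets.Un[OF sets.Diff[OF _ null_setsD2[OF singular_directions_null[OF K fin]]] null_setsD2]
    by simp
qed auto

lemma reverse_radial_gauss_image_eq:
  assumes K: "K \<in> convex_bodies_o" and E: "E \<subseteq> sphere 0 1"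
  shows "reverse_radial_gauss_image K E = {u \<in> sphere 0 1. \<exists>v\<in>E. touching_normal K u v}"
proof (intro equalityI subsetI)
  fix u assume "u \<in> reverse_radial_gauss_image K E"
  then obtain x v where x: "u = x /\<^sub>R norm x" "x \<in> frontier K" "v \<in> E" "x \<bullet> v = support_fun K v"
    by (auto simp: reverse_radial_gauss_image_def support_hyperplane_def)
  have v: "v \<in> sphere 0 1" using x E by auto
  have "x \<in> K" using x(2) convex_bodyD(3)[OF K] by (auto simp: frontier_def)
  have "x \<noteq> 0" using support_fun_pos[OF K v] x(4) by auto
  then have u: "u \<in> sphere 0 1" by (simp add: x(1))
  have xu: "x = norm x *\<^sub>R u" using \<open>x \<noteq> 0\<close> by (simp add: x(1))
  have "norm x \<le> radial_fun K u" using \<open>x \<in> K\<close> xu by (intro radial_fun_greatest[OF K u]) simp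
  moreover have eq: "norm x * (u \<bullet> v) = support_fun K v"
    using x(4) arg_cong[OF xu, of "\<lambda>y. y \<bullet> v"] by simp
  moreover have "0 < u \<bullet> v"
    using support_fun_pos[OF K v] \<open>x \<noteq> 0\<close> unfolding eq[symmetric]
    by (simp add: zero_less_mult_iff)
  ultimately have "support_fun K v \<le> radial_fun K u * (u \<bullet> v)"
    using mult_right_mono[of "norm x" "radial_fun K u" "u \<bullet> v"] by simp
  then have "touching_normal K u v"
    using radial_fun_inner_le[OF K u, of v] v by (simp add: touching_normal_def)
  with u x(3) show "u \<in> {u \<in> sphere 0 1. \<exists>v\<in>E. touching_normal K u v}" by blast
next
  fix u assume "u \<in> {u \<in> sphere 0 1. \<exists>v\<in>E. touching_normal K u v}"
  then obtain v where u: "u \<in> sphere 0 1" and v: "v \<in> E" "touching_normal K u v" by auto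
  define x where "x = radial_fun K u *\<^sub>R u"
  have rho: "0 < radial_fun K u" by (rule radial_fun_pos[OF K u])
  have "x \<in> K" unfolding x_def by (rule radial_fun_mem[OF K u])
  have xv: "x \<bullet> v = support_fun K v" "norm v = 1" using v by (auto simp: x_def touching_normal_def)
  have "x \<notin> interior K"
  proof
    assume "x \<in> interior K"
    then obtain e where e: "0 < e" "cball x e \<subseteq> K" by (auto simp: mem_interior_cball)
    have "x + e *\<^sub>R v \<in> K" using e xv by (intro subsetD[OF e(2)]) (auto simp: dist_norm)
    then have "(x + e *\<^sub>R v) \<bullet> v \<le> support_fun K v"
      by (rule inner_le_support_fun[OF convex_bodyD(1)[OF K]])
    then show False using xv e by (simp add: inner_add_left norm_eq_1)
  qed
  then have "x \<in> frontier K" using \<open>x \<in> K\<close> closure_subset by (auto simp: frontier_def)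
  moreover have "u = x /\<^sub>R norm x" using u rho by (simp add: x_def)
  ultimately show "u \<in> reverse_radial_gauss_image K E"
    using v xv unfolding reverse_radial_gauss_image_def support_hyperplane_def by blast
qed

section \<open>First variation of the radial function\<close>

lemma tendsto_unique_zero:
  fixes m :: "'a::metric_space \<Rightarrow> real"
  assumes S: "compact S" "continuous_on S m" and a: "\<And>x. x \<in> S \<Longrightarrow> x \<noteq> a \<Longrightarrow> 0 < m x"
    and x: "\<And>n. x n \<in> S" "(\<lambda>n. m (x n)) \<longlonglongrightarrow> 0"
  shows "x \<longlonglongrightarrow> a"
proof (rule tendstoI)
  fix e :: real assume "0 < e"
  let ?T = "S - ball a e"
  show "\<forall>\<^sub>F n in sequentially. dist (x n) a < e"
  proof (cases "?T = {}")
    case True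
    then have "dist (x n) a < e" for n using x(1)[of n] by (auto simp: dist_commute)
    then show ?thesis by simp
  next
    case False
    have "compact ?T" using S(1) by (simp add: compact_diff)
    then obtain z where z: "z \<in> ?T" "\<And>y. y \<in> ?T \<Longrightarrow> m z \<le> m y"
      using continuous_attains_inf[OF _ False continuous_on_subset[OF S(2)]] by blast
    have "z \<noteq> a" using z(1) \<open>0 < e\<close> by auto
    then have "0 < m z" using z(1) by (intro a) auto
    with x(2) have "\<forall>\<^sub>F n in sequentially. m (x n) < m z" by (rule order_tendstoD)
    then show ?thesis
    proof eventually_elim
      case (elim n)
      then have "x n \<notin> ?T" using z(2)[of "x n"] by linarith
      then show ?case using x(1)[of n] by (simp add: dist_commute)
    qed
  qed
qed

definition log_perturbation :: "'a::euclidean_space set \<Rightarrow> ('a \<Rightarrow> real) \<Rightarrow> real \<Rightarrow> 'a set" where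
  "log_perturbation K g t = wulff_shape (\<lambda>v. support_fun K v * exp (t * g v))"

lemma
  assumes K: "K \<in> convex_bodies_o" and g: "continuous_on (sphere 0 1) g"
  shows log_perturbation_convex_body: "log_perturbation K g t \<in> convex_bodies_o"
    and support_fun_log_perturbation_le:
      "v \<in> sphere 0 1 \<Longrightarrow> support_fun (log_perturbation K g t) v \<le> support_fun K v * exp (t * g v)"
proof -
  show *: "log_perturbation K g t \<in> convex_bodies_o"
    unfolding log_perturbation_def
    by (intro wulff_shape_convex_body continuous_intros continuous_on_support_fun K g)
      (simp add: support_fun_pos[OF K])
  show "v \<in> sphere 0 1 \<Longrightarrow> support_fun (log_perturbation K g t) v \<le> support_fun K v * exp (t * g v)"
    using * unfolding log_perturbation_def by (rule support_fun_wulff_shape_le)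
qed

definition log_radial_rate :: "'a::euclidean_space set \<Rightarrow> ('a \<Rightarrow> real) \<Rightarrow> real \<Rightarrow> 'a \<Rightarrow> real" where
  "log_radial_rate K g t u = ln (radial_fun (log_perturbation K g t) u / radial_fun K u) / t"

lemma radial_fun_log_perturbation:
  assumes K: "K \<in> convex_bodies_o" and g: "continuous_on (sphere 0 1) g"
    and t: "0 < t" and u: "u \<in> sphere 0 1"
  shows "radial_fun (log_perturbation K g t) u = radial_fun K u * exp (t * log_radial_rate K g t u)"
  using radial_fun_pos[OF K u] radial_fun_pos[OF log_perturbation_convex_body[OF K g] u, of t] t
  by (simp add: log_radial_rate_def)

text \<open>A constraint that is active at \<open>u\<close> for the unperturbed body still bounds the perturbed body.\<close>

lemma log_radial_rate_upper:
  assumes K: "K \<in> convex_bodies_o" and g: "continuous_on (sphere 0 1) g"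
    and t: "0 < t" and u: "u \<in> sphere 0 1" and v: "touching_normal K u v"
  shows "log_radial_rate K g t u \<le> g v"
proof -
  note L = log_perturbation_convex_body[OF K g, of t]
  have v': "v \<in> sphere 0 1" "radial_fun K u * (u \<bullet> v) = support_fun K v"
    using v by (auto simp: touching_normal_def)
  have uv: "0 < u \<bullet> v"
    using support_fun_pos[OF K v'(1)] radial_fun_pos[OF K u] unfolding v'(2)[symmetric]
    by (simp add: zero_less_mult_iff)
  have "radial_fun (log_perturbation K g t) u * (u \<bullet> v) \<le> support_fun K v * exp (t * g v)"
    using radial_fun_inner_le[OF L u] support_fun_log_perturbation_le[OF K g v'(1)] by (rule order_trans)
  also have "\<dots> = radial_fun K u * exp (t * g v) * (u \<bullet> v)" by (simp add: v'(2)[symmetric])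
  finally have "exp (t * log_radial_rate K g t u) \<le> exp (t * g v)"
    using uv radial_fun_pos[OF K u] by (simp add: radial_fun_log_perturbation[OF K g t u])
  then show ?thesis using t by simp
qed

text \<open>Here \<open>v\<close> is a constraint that is active at \<open>u\<close> for the perturbed body; it was satisfied by the
  unperturbed one.\<close>

lemma log_radial_rate_lower:
  assumes K: "K \<in> convex_bodies_o" and g: "continuous_on (sphere 0 1) g"
    and t: "0 < t" and u: "u \<in> sphere 0 1"
  obtains v where "v \<in> sphere 0 1" "g v \<le> log_radial_rate K g t u"
    "radial_fun K u * exp (t * (log_radial_rate K g t u - g v)) * (u \<bullet> v) = support_fun K v"
proof -
  obtain v where v: "v \<in> sphere 0 1"
    "radial_fun (log_perturbation K g t) u * (u \<bullet> v) = support_fun K v * exp (t * g v)"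
    unfolding log_perturbation_def
    using radial_fun_wulff_shape_attained[OF _ _ u, of "\<lambda>v. support_fun K v * exp (t * g v)"]
      support_fun_pos[OF K]
    by (force intro!: continuous_intros continuous_on_support_fun[OF K] g)
  have h: "0 < support_fun K v" by (rule support_fun_pos[OF K v(1)])
  have eq: "radial_fun K u * exp (t * (log_radial_rate K g t u - g v)) * (u \<bullet> v) = support_fun K v"
    using v(2) by (simp add: radial_fun_log_perturbation[OF K g t u] right_diff_distrib exp_diff field_simps)
  have "1 \<le> exp (t * (log_radial_rate K g t u - g v))"
  proof (rule ccontr)
    assume "\<not> ?thesis"
    then have "exp (t * (log_radial_rate K g t u - g v)) * support_fun K v < 1 * support_fun K v"
      using h by (intro mult_strict_right_mono) auto
    moreover have "support_fun K v \<le> exp (t * (log_radial_rate K g t u - g v)) * support_fun K v"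
      using mult_left_mono[OF radial_fun_inner_le[OF K u, of v], of "exp (t * (log_radial_rate K g t u - g v))"]
      by (subst eq[symmetric]) (simp add: ac_simps)
    ultimately show False by simp
  qed
  then have "g v \<le> log_radial_rate K g t u" using t by (simp add: zero_le_mult_iff)
  then show thesis by (intro that[OF v(1) _ eq])
qed

lemma abs_log_radial_rate_le:
  assumes K: "K \<in> convex_bodies_o" and g: "continuous_on (sphere 0 1) g"
    and Q: "\<And>v. v \<in> sphere 0 1 \<Longrightarrow> \<bar>g v\<bar> \<le> Q"
    and t: "0 < t" and u: "u \<in> sphere 0 1"
  shows "\<bar>log_radial_rate K g t u\<bar> \<le> Q"
proof -
  obtain v where v: "touching_normal K u v" using touching_normal_exists[OF K u] by blast
  obtain w where w: "w \<in> sphere 0 1" "g w \<le> log_radial_rate K g t u"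
    using log_radial_rate_lower[OF K g t u] by blast
  have "v \<in> sphere 0 1" using v by (simp add: touching_normal_def)
  then show ?thesis
    using log_radial_rate_upper[OF K g t u v] w(2) Q[of v] Q[OF w(1)] by linarith
qed

text \<open>Envelope theorem: only the constraint that is active at \<open>u\<close>, the one at its unique outer
  normal, matters to first order, since the active normals of the perturbed bodies converge to it.\<close>

lemma log_radial_rate_tendsto:
  assumes K: "K \<in> convex_bodies_o" and g: "continuous_on (sphere 0 1) g"
    and t: "\<And>n. 0 < t n" "t \<longlonglongrightarrow> 0" and u: "u \<in> sphere 0 1" "u \<notin> singular_directions K"
  shows "(\<lambda>n. log_radial_rate K g (t n) u) \<longlonglongrightarrow> g (normal_choice K u)"
proof -
  let ?a = "normal_choice K u" and ?q = "\<lambda>n. log_radial_rate K g (t n) u"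
  have "\<exists>v. v \<in> sphere 0 1 \<and> g v \<le> ?q n \<and>
      radial_fun K u * exp (t n * (?q n - g v)) * (u \<bullet> v) = support_fun K v" for n
    by (rule log_radial_rate_lower[OF K g t(1)[of n] u(1)]) blast
  then obtain v where v: "\<And>n. v n \<in> sphere 0 1" "\<And>n. g (v n) \<le> ?q n"
    "\<And>n. radial_fun K u * exp (t n * (?q n - g (v n))) * (u \<bullet> v n) = support_fun K (v n)"
    by metis
  obtain Q where Q: "\<And>v. v \<in> sphere 0 1 \<Longrightarrow> \<bar>g v\<bar> \<le> Q"
    using continuous_on_sphere_bounded[OF g] by blast
  have qQ: "\<bar>?q n\<bar> \<le> Q" for n by (rule abs_log_radial_rate_le[OF K g Q t(1) u(1)])
  have "(\<lambda>n. t n * (?q n - g (v n))) \<longlonglongrightarrow> 0"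
  proof (rule Lim_null_comparison)
    show "\<forall>\<^sub>F n in sequentially. norm (t n * (?q n - g (v n))) \<le> t n * (2 * Q)"
    proof (intro always_eventually allI)
      fix n
      have "\<bar>?q n - g (v n)\<bar> \<le> 2 * Q" using qQ[of n] Q[OF v(1)[of n]] by linarith
      then show "norm (t n * (?q n - g (v n))) \<le> t n * (2 * Q)"
        using t(1)[of n] by (simp add: abs_mult)
    qed
    show "(\<lambda>n. t n * (2 * Q)) \<longlonglongrightarrow> 0" using tendsto_mult_left_zero[OF t(2)] by simp
  qed
  then have e: "(\<lambda>n. exp (t n * (?q n - g (v n))) - 1) \<longlonglongrightarrow> 0"
    using tendsto_diff[OF tendsto_exp tendsto_const, of _ 0 _ 1] by simp
  define m where "m w = support_fun K w - radial_fun K u * (u \<bullet> w)" for w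
  have "(\<lambda>n. m (v n)) \<longlonglongrightarrow> 0"
  proof (rule Lim_null_comparison)
    show "\<forall>\<^sub>F n in sequentially. norm (m (v n)) \<le> radial_fun K u * (exp (t n * (?q n - g (v n))) - 1)"
    proof (intro always_eventually allI)
      fix n
      let ?e = "exp (t n * (?q n - g (v n)))"
      have "1 \<le> ?e" using v(2)[of n] t(1)[of n] by simp
      have "m (v n) = radial_fun K u * (?e - 1) * (u \<bullet> v n)"
        unfolding m_def v(3)[of n, symmetric] by (simp add: algebra_simps)
      moreover have "\<bar>u \<bullet> v n\<bar> \<le> 1"
        using Cauchy_Schwarz_ineq2[of u "v n"] u(1) v(1)[of n] by simp
      ultimately show "norm (m (v n)) \<le> radial_fun K u * (?e - 1)"
        using \<open>1 \<le> ?e\<close> radial_fun_pos[OF K u(1)]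
          mult_left_mono[of "\<bar>u \<bullet> v n\<bar>" 1 "radial_fun K u * (?e - 1)"]
        by (simp add: abs_mult)
    qed
    show "(\<lambda>n. radial_fun K u * (exp (t n * (?q n - g (v n))) - 1)) \<longlonglongrightarrow> 0"
      using tendsto_mult_right_zero[OF e] by simp
  qed
  moreover have "0 < m w" if "w \<in> sphere 0 1" "w \<noteq> ?a" for w
    using touching_normal_unique[OF K u, of w] radial_fun_inner_le[OF K u(1), of w] that
    unfolding touching_normal_def m_def by force
  moreover have "continuous_on (sphere 0 1) m"
    unfolding m_def by (intro continuous_intros continuous_on_support_fun[OF K])
  ultimately have "v \<longlonglongrightarrow> ?a" by (intro tendsto_unique_zero[OF compact_sphere _ _ v(1)])
  then have gv: "(\<lambda>n. g (v n)) \<longlonglongrightarrow> g ?a"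
    using v(1) normal_choice_in_sphere[OF K u(1)]
    by (intro continuous_on_tendsto_compose[OF g]) auto
  show ?thesis
    by (rule tendsto_sandwich[OF _ _ gv tendsto_const])
      (use v(2) log_radial_rate_upper[OF K g t(1) u(1) normal_choice_touching[OF K u(1)]] in auto)
qed

section \<open>Integrals of continuous functions\<close>

text \<open>Differentiation under the integral sign along increments \<open>t n * q n x\<close> whose rates \<open>q n x\<close>
  depend on the point and converge almost everywhere.\<close>

lemma integral_difference_quotient_tendsto:
  fixes F F' :: "real \<Rightarrow> 'a \<Rightarrow> real"
  assumes M: "finite_measure M"
    and t: "\<And>n. 0 < t n" "\<And>n. t n \<le> 1" "t \<longlonglongrightarrow> 0"
    and meas: "\<And>n. (\<lambda>x. F (t n * q n x) x) \<in> borel_measurable M"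
      "(\<lambda>x. F' 0 x * p x) \<in> borel_measurable M"
    and int0: "integrable M (F 0)"
    and q: "\<And>n x. x \<in> space M \<Longrightarrow> \<bar>q n x\<bar> \<le> Q" "AE x in M. (\<lambda>n. q n x) \<longlonglongrightarrow> p x"
    and deriv: "\<And>s x. x \<in> space M \<Longrightarrow> \<bar>s\<bar> \<le> Q \<Longrightarrow> ((\<lambda>s. F s x) has_real_derivative F' s x) (at s)"
    and bound: "\<And>s x. x \<in> space M \<Longrightarrow> \<bar>s\<bar> \<le> Q \<Longrightarrow> \<bar>F' s x\<bar> \<le> B"
  shows "(\<lambda>n. ((LINT x|M. F (t n * q n x) x) - (LINT x|M. F 0 x)) / t n)
    \<longlonglongrightarrow> (LINT x|M. F' 0 x * p x)"
proof (cases "space M = {}")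
  case True
  then have "(LINT x|M. f x) = 0" for f :: "'a \<Rightarrow> real"
    by (intro integral_eq_zero_AE AE_I2) simp
  then show ?thesis by simp
next
  case False
  interpret finite_measure M by fact
  have "0 \<le> Q" using False q(1) by (metis abs_ge_zero all_not_in_conv order_trans)
  define D where "D n x = (F (t n * q n x) x - F 0 x) / t n" for n x
  have tq: "\<bar>t n * q n x\<bar> \<le> Q" if "x \<in> space M" for n x
  proof -
    have "\<bar>t n\<bar> * \<bar>q n x\<bar> \<le> 1 * Q"
      using t(1)[of n] t(2)[of n] q(1)[OF that, of n] by (intro mult_mono) auto
    then show ?thesis by (simp add: abs_mult)
  qed
  have Dbound: "\<bar>D n x\<bar> \<le> B * Q" if x: "x \<in> space M" for n x
  proof -
    have "norm (F (t n * q n x) x - F 0 x) \<le> B * norm (t n * q n x - 0)"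
    proof (rule field_differentiable_bound[of "{-Q..Q}"])
      show "((\<lambda>s. F s x) has_field_derivative F' s x) (at s within {-Q..Q})" if "s \<in> {-Q..Q}" for s
        using that by (intro has_field_derivative_at_within[OF deriv[OF x]]) auto
      show "norm (F' s x) \<le> B" if "s \<in> {-Q..Q}" for s
        using that bound[OF x, of s] by auto
    qed (use tq[OF x, of n] \<open>0 \<le> Q\<close> in auto)
    also have "\<dots> \<le> B * (t n * Q)"
      using bound[OF x, of 0] \<open>0 \<le> Q\<close> q(1)[OF x, of n] t(1)[of n]
      by (intro mult_left_mono) (auto simp: abs_mult)
    finally show ?thesis using t(1)[of n] by (simp add: D_def field_simps)
  qed
  have Dlim: "AE x in M. (\<lambda>n. D n x) \<longlonglongrightarrow> F' 0 x * p x"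
    using q(2)
  proof (rule AE_mp, intro AE_I2 impI)
    fix x assume x: "x \<in> space M" and qx: "(\<lambda>n. q n x) \<longlonglongrightarrow> p x"
    obtain l where l: "\<And>s. F s x - F 0 x = l s * s" "isCont l 0" "l 0 = F' 0 x"
      using deriv[OF x, of 0] \<open>0 \<le> Q\<close> unfolding CARAT_DERIV by auto
    have "(\<lambda>n. t n * q n x) \<longlonglongrightarrow> 0" using tendsto_mult[OF t(3) qx] by simp
    then have "(\<lambda>n. l (t n * q n x)) \<longlonglongrightarrow> F' 0 x"
      using isCont_tendsto_compose[OF l(2)] l(3) by simp
    then have "(\<lambda>n. l (t n * q n x) * q n x) \<longlonglongrightarrow> F' 0 x * p x" using qx by (rule tendsto_mult)
    moreover have "l (t n * q n x) * q n x = D n x" for n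
      using t(1)[of n] unfolding D_def l(1) by simp
    ultimately show "(\<lambda>n. D n x) \<longlonglongrightarrow> F' 0 x * p x" by simp
  qed
  have Dmeas: "D n \<in> borel_measurable M" for n
    unfolding D_def using meas(1)[of n] int0 by measurable
  have "(\<lambda>n. LINT x|M. D n x) \<longlonglongrightarrow> (LINT x|M. F' 0 x * p x)"
    by (rule integral_dominated_convergence[where w = "\<lambda>_. B * Q"])
      (use Dbound Dlim Dmeas meas(2) in auto)
  moreover have "(LINT x|M. D n x) = ((LINT x|M. F (t n * q n x) x) - (LINT x|M. F 0 x)) / t n" for n
  proof -
    have "integrable M (D n)"
      by (rule integrable_const_bound[of _ "B * Q"]) (use Dbound Dmeas in auto)
    then have "integrable M (\<lambda>x. t n * D n x + F 0 x)" using int0 by simp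
    moreover have "t n * D n x + F 0 x = F (t n * q n x) x" for x
      using t(1)[of n] by (simp add: D_def)
    ultimately have "integrable M (\<lambda>x. F (t n * q n x) x)" by simp
    then show ?thesis unfolding D_def using int0 by simp
  qed
  ultimately show ?thesis by simp
qed

text \<open>The indicator of a closed set is the limit of the continuous functions
  \<open>max 0 (1 - n * infdist x C)\<close>, so the measures agree on closed sets, which generate the Borel sets.\<close>

lemma finite_borel_measure_eqI:
  fixes M N :: "'a::metric_space measure"
  assumes M: "finite_measure M" "sets M = sets borel" and N: "finite_measure N" "sets N = sets borel"
    and eq: "\<And>g. continuous_on UNIV g \<Longrightarrow> (\<And>x. 0 \<le> g x) \<Longrightarrow> (\<And>x. g x \<le> (1::real)) \<Longrightarrow>
      integral\<^sup>L M g = integral\<^sup>L N g"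
  shows "M = N"
proof (rule measure_eqI_generator_eq)
  show "Int_stable (Collect closed :: 'a set set)" by (auto simp: Int_stable_def)
  show "emeasure M C = emeasure N C" if "C \<in> Collect closed" for C
  proof (cases "C = {}")
    case False
    have "closed C" using that by simp
    define g where "g n x = max 0 (1 - real n * infdist x C)" for n x
    have g: "continuous_on UNIV (g n)" "0 \<le> g n x" "g n x \<le> 1" for n x
      unfolding g_def by (auto intro!: continuous_intros simp: infdist_nonneg)
    have lim: "(\<lambda>n. g n x) \<longlonglongrightarrow> indicator C x" for x
    proof (cases "x \<in> C")
      case True
      then show ?thesis by (simp add: g_def)
    next
      case out: False
      then have "0 < infdist x C"
        using in_closed_iff_infdist_zero[OF \<open>closed C\<close> False] infdist_nonneg[of x C] by (simp add: less_le)
      then obtain k :: nat where k: "1 < real k * infdist x C" using reals_Archimedean3 by blast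
      have "g n x = 0" if "k \<le> n" for n
      proof -
        have "real k * infdist x C \<le> real n * infdist x C"
          using that by (intro mult_right_mono infdist_nonneg) auto
        with k show ?thesis by (simp add: g_def)
      qed
      then have "\<forall>\<^sub>F n in sequentially. g n x = 0" by (rule eventually_sequentiallyI)
      with out show ?thesis by (simp add: tendsto_eventually)
    qed
    have conv: "(\<lambda>n. integral\<^sup>L L (g n)) \<longlonglongrightarrow> measure L C"
      if L: "finite_measure L" "sets L = sets borel" for L :: "'a measure"
    proof -
      interpret L: finite_measure L by fact
      have CL: "C \<in> sets L" using \<open>closed C\<close> L(2) by simp
      have "(\<lambda>n. integral\<^sup>L L (g n)) \<longlonglongrightarrow> integral\<^sup>L L (indicator C :: 'a \<Rightarrow> real)"
      proof (rule integral_dominated_convergence[where w = "\<lambda>_. 1"])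
        show "g n \<in> borel_measurable L" for n
          using borel_measurable_continuous_onI[OF g(1)[of n]] measurable_cong_sets[OF L(2) refl] by blast
        show "(indicator C :: 'a \<Rightarrow> real) \<in> borel_measurable L" using CL by simp
      qed (use g lim in auto)
      then show ?thesis using CL sets.sets_into_space[OF CL] by (simp add: Int_absorb2)
    qed
    have "integral\<^sup>L M (g n) = integral\<^sup>L N (g n)" for n by (intro eq g)
    then have "measure M C = measure N C"
      using LIMSEQ_unique[OF conv[OF M]] conv[OF N] by simp
    then show ?thesis
      using finite_measure.emeasure_eq_measure M(1) N(1) by metis
  qed simp
  show "sets M = sigma_sets UNIV (Collect closed)" "sets N = sigma_sets UNIV (Collect closed)"
    unfolding M N borel_eq_closed by simp_all
  show "range (\<lambda>_::nat. UNIV) \<subseteq> (Collect closed :: 'a set set)" by auto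
  show "emeasure M UNIV \<noteq> \<infinity>" for i :: nat
    using finite_measure.emeasure_finite[OF M(1)] by simp
qed auto

section \<open>The logarithmic potential\<close>

text \<open>The primitive that makes \<open>\<psi>\<close> appear in the first variation: the derivative of
  \<open>log_potential \<psi> (h * exp s)\<close> in \<open>s\<close> is \<open>\<psi> (h * exp s)\<close>.\<close>

definition log_potential :: "(real \<Rightarrow> real) \<Rightarrow> real \<Rightarrow> real" where
  "log_potential \<psi> t = (LBINT s=1..t. \<psi> s / s)"

lemma DERIV_log_potential:
  assumes "continuous_on {0<..} \<psi>" "0 < t"
  shows "(log_potential \<psi> has_real_derivative \<psi> t / t) (at t)"
proof -
  define a b where "a = min t 1 / 2" and "b = max t 1 + 1"
  have ab: "0 < a" "a < 1" "1 < b" "a < t" "t < b" using assms(2) by (auto simp: a_def b_def)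
  have "continuous_on {a..b} (\<lambda>s. \<psi> s / s)"
    using ab by (intro continuous_intros continuous_on_subset[OF assms(1)]) auto
  then have "((\<lambda>u. LBINT s=1..u. \<psi> s / s) has_vector_derivative \<psi> t / t) (at t within {a..b})"
    unfolding one_ereal_def using ab by (intro interval_integral_FTC2) auto
  then have "(log_potential \<psi> has_real_derivative \<psi> t / t) (at t within {a..b})"
    unfolding log_potential_def has_real_derivative_iff_has_vector_derivative .
  moreover have "at t within {a..b} = at t" using ab by (intro at_within_interior) simp
  ultimately show ?thesis by simp
qed

lemma log_potential_mono:
  assumes "continuous_on {0<..} \<psi>" and pos: "\<And>s. 0 < s \<Longrightarrow> 0 < \<psi> s" and "0 < s" "s \<le> t"
  shows "log_potential \<psi> s \<le> log_potential \<psi> t"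
proof (rule DERIV_nonneg_imp_nondecreasing[OF \<open>s \<le> t\<close>])
  fix x assume "s \<le> x" "x \<le> t"
  then have "0 < x" using \<open>0 < s\<close> by simp
  then show "\<exists>y. (log_potential \<psi> has_real_derivative y) (at x) \<and> 0 \<le> y"
    using DERIV_log_potential[OF assms(1)] pos[of x] by (intro exI[of _ "\<psi> x / x"]) simp
qed

text \<open>A bounded increasing primitive would have a limit, and the integral would be finite.\<close>

lemma log_potential_unbounded:
  assumes cont: "continuous_on {0<..} \<psi>" and pos: "\<And>s. 0 < s \<Longrightarrow> 0 < \<psi> s"
    and int: "(\<integral>\<^sup>+ s \<in> {1..}. ennreal (\<psi> s / s) \<partial>lborel) = \<infinity>"
  shows "\<exists>t\<ge>1. C < log_potential \<psi> t"
proof (rule ccontr)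
  assume "\<not> ?thesis"
  then have bd: "log_potential \<psi> t \<le> C" if "1 \<le> t" for t using that by force
  define T where "T = Sup (log_potential \<psi> ` {1..})"
  have bdd: "bdd_above (log_potential \<psi> ` {1..})" using bd by (auto simp: bdd_above_def)
  have lim: "(log_potential \<psi> \<longlongrightarrow> T) at_top"
  proof (rule increasing_tendsto)
    show "\<forall>\<^sub>F t in at_top. log_potential \<psi> t \<le> T"
      unfolding T_def using eventually_ge_at_top[of "1::real"]
      by eventually_elim (auto intro: cSUP_upper bdd)
    fix y assume "y < T"
    then obtain s where s: "1 \<le> s" "y < log_potential \<psi> s"
      unfolding T_def using less_cSUP_iff[OF _ bdd, of y] by auto
    show "\<forall>\<^sub>F t in at_top. y < log_potential \<psi> t"
      using eventually_ge_at_top[of s]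
    proof eventually_elim
      case (elim t)
      have "log_potential \<psi> s \<le> log_potential \<psi> t"
        using s(1) elim by (intro log_potential_mono[OF cont pos]) auto
      then show ?case using s(2) by linarith
    qed
  qed
  define f where "f s = indicator {1..} s *\<^sub>R (\<psi> s / s)" for s :: real
  have fm: "f \<in> borel_measurable borel"
    unfolding f_def
    by (intro borel_measurable_continuous_on_indicator continuous_intros continuous_on_subset[OF cont]) auto
  have "(\<integral>\<^sup>+s. ennreal (f s) * indicator {1..} s \<partial>lborel) = T - log_potential \<psi> 1"
  proof (rule nn_integral_FTC_atLeast[OF fm _ _ lim])
    show "DERIV (log_potential \<psi>) x :> f x" "0 \<le> f x" if "1 \<le> x" for x
      using DERIV_log_potential[OF cont, of x] pos[of x] that by (auto simp: f_def)
  qed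
  moreover have "(\<integral>\<^sup>+s. ennreal (f s) * indicator {1..} s \<partial>lborel)
      = (\<integral>\<^sup>+ s \<in> {1..}. ennreal (\<psi> s / s) \<partial>lborel)"
    by (intro nn_integral_cong) (auto simp: f_def indicator_def)
  ultimately show False using int by simp
qed

section \<open>Dual volume and entropy\<close>

lemma sphere_cap_borel: "sphere_cap \<epsilon> v \<in> sets borel" "sphere_cap \<epsilon> v \<subseteq> sphere 0 1"
proof -
  have "sphere_cap \<epsilon> v = sphere 0 1 \<inter> {u. \<epsilon> \<le> v \<bullet> u}"
    by (auto simp: sphere_cap_def inner_commute)
  also have "closed \<dots>" by (intro closed_Int closed_sphere closed_halfspace_ge)
  finally show "sphere_cap \<epsilon> v \<in> sets borel" by (rule borel_closed)
qed (auto simp: sphere_cap_def)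

lemma sphere_cap_mono:
  assumes "u \<in> sphere 0 1" "norm (v - w) \<le> \<delta>"
  shows "u \<bullet> w - \<delta> \<le> u \<bullet> v"
proof -
  have "u \<bullet> (w - v) \<le> norm u * norm (w - v)" by (rule norm_cauchy_schwarz)
  then show ?thesis using assms by (simp add: inner_diff_right norm_minus_commute)
qed

locale dual_Orlicz_problem =
  fixes \<mu> :: "'a::euclidean_space measure"
    and G :: "real \<Rightarrow> 'a \<Rightarrow> real"
    and \<psi> :: "real \<Rightarrow> real"
    and \<epsilon>\<^sub>0 :: real
  assumes mu_Borel: "finite_Borel_measure_on_sphere \<mu>"
    and mu_nonzero: "measure \<mu> (sphere 0 1) \<noteq> 0"
    and mu_hemisphere: "not_concentrated_on_closed_hemisphere \<mu>"
    and G_pos: "\<And>t u. 0 < t \<Longrightarrow> u \<in> sphere 0 1 \<Longrightarrow> 0 < G t u"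
    and G_diff: "\<And>t u. 0 < t \<Longrightarrow> u \<in> sphere 0 1 \<Longrightarrow> (\<lambda>s. G s u) differentiable (at t)"
    and G_cont: "continuous_on ({0<..} \<times> sphere 0 1) (\<lambda>(t, u). G t u)"
    and Gt_cont: "continuous_on ({0<..} \<times> sphere 0 1) (\<lambda>(t, u). partial_t G t u)"
    and Gt_neg: "\<And>t u. 0 < t \<Longrightarrow> u \<in> sphere 0 1 \<Longrightarrow> partial_t G t u < 0"
    and eps0: "0 < \<epsilon>\<^sub>0" "\<epsilon>\<^sub>0 < 1"
    and G_lim_0: "\<And>v \<epsilon>. v \<in> sphere 0 1 \<Longrightarrow> 0 < \<epsilon> \<Longrightarrow> \<epsilon> \<le> \<epsilon>\<^sub>0 \<Longrightarrow>
      filterlim (\<lambda>t. LINT u : sphere_cap \<epsilon> v | sphere_measure. G t u) at_top (at_right 0)"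
    and psi_pos: "\<And>s. 0 < s \<Longrightarrow> 0 < \<psi> s"
    and psi_cont: "continuous_on {0<..} \<psi>"
    and psi_int: "(\<integral>\<^sup>+ s \<in> {1..}. ennreal (\<psi> s / s) \<partial>lborel) = \<infinity>"
begin

abbreviation S :: "'a set" where "S \<equiv> sphere 0 1"

lemma DERIV_G:
  assumes "0 < t" "u \<in> S"
  shows "((\<lambda>s. G s u) has_real_derivative partial_t G t u) (at t)"
  unfolding partial_t_def DERIV_deriv_iff_real_differentiable by (rule G_diff[OF assms])

lemma G_antimono:
  assumes "0 < s" "s \<le> t" "u \<in> S"
  shows "G t u \<le> G s u"
proof (rule DERIV_nonpos_imp_nonincreasing[OF \<open>s \<le> t\<close>])
  fix x assume "s \<le> x" "x \<le> t"
  then have "0 < x" using \<open>0 < s\<close> by simp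
  then show "\<exists>y. ((\<lambda>t. G t u) has_real_derivative y) (at x) \<and> y \<le> 0"
    using DERIV_G[of x u] Gt_neg[of x u] \<open>u \<in> S\<close> by (intro exI[of _ "partial_t G x u"]) simp
qed

lemma continuous_on_G_compose:
  assumes "continuous_on S f" "\<And>u. u \<in> S \<Longrightarrow> 0 < f u"
  shows "continuous_on S (\<lambda>u. G (f u) u)" "continuous_on S (\<lambda>u. partial_t G (f u) u)"
proof -
  have p: "continuous_on S (\<lambda>u. (f u, u))" using assms(1) by (intro continuous_intros)
  have im: "(\<lambda>u. (f u, u)) ` S \<subseteq> {0<..} \<times> S" using assms(2) by auto
  show "continuous_on S (\<lambda>u. G (f u) u)" "continuous_on S (\<lambda>u. partial_t G (f u) u)"
    using continuous_on_compose2[OF G_cont p im] continuous_on_compose2[OF Gt_cont p im] by simp_all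
qed

lemma cap_integral_large:
  assumes "v \<in> S"
  shows "\<forall>\<^sub>F t in at_right 0. C < (LINT u : sphere_cap \<epsilon>\<^sub>0 v | sphere_measure. G t u)"
  using G_lim_0[OF assms eps0(1) order_refl] by (simp add: filterlim_at_top_dense)

text \<open>A Bochner integral that tends to infinity is eventually nonzero, so its integrand is
  integrable; as \<open>G\<close> is bounded below on the sphere, every cap has finite measure.\<close>

lemma emeasure_cap_finite:
  assumes "v \<in> S"
  shows "emeasure sphere_measure (sphere_cap \<epsilon>\<^sub>0 v) < \<infinity>"
proof -
  have "\<forall>\<^sub>F t::real in at_right 0. 0 < t" by (simp add: eventually_at_right_less)
  with cap_integral_large[OF assms, of 0]
  have "\<forall>\<^sub>F t in at_right 0. 0 < t \<and> 0 < (LINT u : sphere_cap \<epsilon>\<^sub>0 v | sphere_measure. G t u)"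
    by eventually_elim auto
  then obtain t where t: "0 < t" "0 < (LINT u : sphere_cap \<epsilon>\<^sub>0 v | sphere_measure. G t u)"
    using eventually_happens[of _ "at_right (0::real)"] by auto
  then have int: "integrable sphere_measure (\<lambda>u. indicator (sphere_cap \<epsilon>\<^sub>0 v) u *\<^sub>R G t u)"
    unfolding set_lebesgue_integral_def using not_integrable_integral_eq by force
  have "continuous_on S (\<lambda>u. G t u)" using t(1) by (intro continuous_on_G_compose continuous_intros)
  then obtain w where w: "w \<in> S" "\<And>u. u \<in> S \<Longrightarrow> G t w \<le> G t u"
    using continuous_attains_inf[OF compact_sphere sphere_nonempty] by blast
  have cap: "sphere_cap \<epsilon>\<^sub>0 v \<in> sets sphere_measure"
    by (intro borel_subset_in_sets_sphere_measure sphere_cap_borel)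
  have "integrable sphere_measure (indicator (sphere_cap \<epsilon>\<^sub>0 v) :: 'a \<Rightarrow> real)"
  proof (rule Bochner_Integration.integrable_bound)
    show "integrable sphere_measure (\<lambda>u. (indicator (sphere_cap \<epsilon>\<^sub>0 v) u *\<^sub>R G t u) / G t w)"
      using int by (rule integrable_divide_zero)
    show "AE u in sphere_measure. norm (indicator (sphere_cap \<epsilon>\<^sub>0 v) u :: real)
        \<le> norm ((indicator (sphere_cap \<epsilon>\<^sub>0 v) u *\<^sub>R G t u) / G t w)"
    proof (rule AE_I2)
      fix u :: 'a assume "u \<in> space sphere_measure"
      then have "0 < G t w" "G t w \<le> G t u"
        using G_pos[OF t(1) w(1)] w(2) by (auto simp: space_sphere_measure)
      then show "norm (indicator (sphere_cap \<epsilon>\<^sub>0 v) u :: real)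
          \<le> norm ((indicator (sphere_cap \<epsilon>\<^sub>0 v) u *\<^sub>R G t u) / G t w)"
        by (auto simp: indicator_def)
    qed
  qed (use cap in simp)
  then show ?thesis
    using sphere_cap_borel(2)[of \<epsilon>\<^sub>0 v] by (simp add: integrable_indicator_iff space_sphere_measure Int_absorb2)
qed

lemma cap_net:
  obtains T where "finite T" "T \<subseteq> S" "\<And>v. v \<in> S \<Longrightarrow> \<exists>w\<in>T. norm (v - w) \<le> \<epsilon>\<^sub>0 / 2 \<and> norm (v - w) \<le> 1 - \<epsilon>\<^sub>0"
proof -
  define d where "d = min (\<epsilon>\<^sub>0 / 2) (1 - \<epsilon>\<^sub>0)"
  have "0 < d" using eps0 by (simp add: d_def)
  have "S \<subseteq> (\<Union>w\<in>S. ball w d)" using \<open>0 < d\<close> by auto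
  then obtain T where T: "T \<subseteq> S" "finite T" "S \<subseteq> (\<Union>w\<in>T. ball w d)"
    using compactE_image[OF compact_sphere[of "0::'a" 1], of S "\<lambda>w. ball w d"] by auto
  show thesis
  proof (rule that[OF T(2,1)])
    fix v assume "v \<in> S"
    then obtain w where "w \<in> T" "norm (v - w) < d" using T(3) by (auto simp: dist_norm norm_minus_commute)
    then show "\<exists>w\<in>T. norm (v - w) \<le> \<epsilon>\<^sub>0 / 2 \<and> norm (v - w) \<le> 1 - \<epsilon>\<^sub>0"
      by (intro bexI[of _ w]) (auto simp: d_def)
  qed
qed

text \<open>A finite net of centres already covers the sphere with caps.\<close>

lemma emeasure_sphere_finite: "emeasure sphere_measure S < \<infinity>"
proof -
  obtain T where T: "finite T" "T \<subseteq> S"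
    "\<And>v. v \<in> S \<Longrightarrow> \<exists>w\<in>T. norm (v - w) \<le> \<epsilon>\<^sub>0 / 2 \<and> norm (v - w) \<le> 1 - \<epsilon>\<^sub>0"
    using cap_net by blast
  have sub: "S \<subseteq> (\<Union>w\<in>T. sphere_cap \<epsilon>\<^sub>0 w)"
  proof
    fix v assume v: "v \<in> S"
    then obtain w where w: "w \<in> T" "norm (v - w) \<le> 1 - \<epsilon>\<^sub>0" using T(3) by blast
    have "v \<bullet> v - (1 - \<epsilon>\<^sub>0) \<le> v \<bullet> w"
      using sphere_cap_mono[OF v, of w v "1 - \<epsilon>\<^sub>0"] w by (simp add: norm_minus_commute)
    then have "v \<in> sphere_cap \<epsilon>\<^sub>0 w" using v by (simp add: sphere_cap_def norm_eq_1)
    with w show "v \<in> (\<Union>w\<in>T. sphere_cap \<epsilon>\<^sub>0 w)" by blast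
  qed
  have caps: "sphere_cap \<epsilon>\<^sub>0 w \<in> sets sphere_measure" for w :: 'a
    by (intro borel_subset_in_sets_sphere_measure sphere_cap_borel)
  have "emeasure sphere_measure S \<le> emeasure sphere_measure (\<Union>w\<in>T. sphere_cap \<epsilon>\<^sub>0 w)"
    by (intro emeasure_mono sub sets.finite_UN T caps)
  also have "\<dots> \<le> (\<Sum>w\<in>T. emeasure sphere_measure (sphere_cap \<epsilon>\<^sub>0 w))"
    using caps by (intro emeasure_subadditive_finite T) auto
  also have "\<dots> < \<infinity>"
    using emeasure_cap_finite T by (auto simp: less_top ennreal_sum_less_top subset_iff)
  finally show ?thesis .
qed

sublocale sigma: finite_measure "sphere_measure :: 'a measure"
  by standard (use emeasure_sphere_finite in \<open>simp add: space_sphere_measure less_top\<close>)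

lemma measure_sphere_pos: "0 < measure sphere_measure S"
proof (rule ccontr)
  assume "\<not> 0 < measure sphere_measure S"
  then have "measure sphere_measure S = 0" using measure_nonneg[of sphere_measure S] by linarith
  then have null: "S \<in> null_sets sphere_measure"
    by (auto simp: null_sets_def sigma.emeasure_eq_measure borel_subset_in_sets_sphere_measure)
  obtain v where v: "v \<in> S" using sphere_nonempty by blast
  obtain t where t: "0 < (LINT u : sphere_cap \<epsilon>\<^sub>0 v | sphere_measure. G t u)"
    using eventually_happens[OF cap_integral_large[OF v, of 0]] by auto
  have "(LINT u : sphere_cap \<epsilon>\<^sub>0 v | sphere_measure. G t u) = 0"
    unfolding set_lebesgue_integral_def
  proof (rule integral_eq_zero_AE)
    have "AE u in sphere_measure. u \<notin> S" by (rule AE_not_in[OF null])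
    then show "AE u in sphere_measure. indicator (sphere_cap \<epsilon>\<^sub>0 v) u *\<^sub>R G t u = 0"
      by eventually_elim (use sphere_cap_borel(2)[of \<epsilon>\<^sub>0 v] in \<open>auto simp: indicator_def\<close>)
  qed
  with t show False by simp
qed

lemma sets_mu: "sets \<mu> = sets (restrict_space borel S)" and space_mu: "space \<mu> = S"
  using mu_Borel sets_eq_imp_space_eq[of \<mu> "restrict_space borel S"]
  by (auto simp: finite_Borel_measure_on_sphere_def space_restrict_space)

sublocale mu: finite_measure \<mu>
  using mu_Borel by (simp add: finite_Borel_measure_on_sphere_def)

lemma integrable_continuous:
  fixes f :: "'a \<Rightarrow> real"
  assumes f: "continuous_on S f"
  shows "integrable \<mu> f" "integrable sphere_measure f"
proof -
  have fr: "f \<in> borel_measurable (restrict_space borel S)"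
    by (rule borel_measurable_continuous_on_restrict[OF f])
  then have m: "f \<in> borel_measurable \<mu>" "f \<in> borel_measurable sphere_measure"
    using measurable_cong_sets[OF sets_mu refl] measurable_sphere_measure_of_borel by blast+
  obtain B where "\<And>u. u \<in> S \<Longrightarrow> \<bar>f u\<bar> \<le> B" using continuous_on_sphere_bounded[OF f] by blast
  then show "integrable \<mu> f" "integrable sphere_measure f"
    using m by (auto intro!: mu.integrable_const_bound[of _ B] sigma.integrable_const_bound[of _ B]
        AE_I2 simp: space_mu space_sphere_measure)
qed

text \<open>Smaller bodies have larger dual volume, since \<open>G\<close> decreases in its first argument.\<close>

definition dual_volume :: "'a set \<Rightarrow> real" where
  "dual_volume K = (LINT u|sphere_measure. G (radial_fun K u) u)"

definition entropy :: "'a set \<Rightarrow> real" where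
  "entropy K = (LINT v|\<mu>. log_potential \<psi> (support_fun K v))"

lemma continuous_on_log_potential: "continuous_on {0<..} (log_potential \<psi>)"
  using DERIV_log_potential[OF psi_cont]
  by (intro continuous_at_imp_continuous_on ballI) (auto intro: DERIV_isCont)

lemma continuous_on_log_potential_compose:
  assumes "continuous_on S f" "\<And>u. u \<in> S \<Longrightarrow> 0 < f u"
  shows "continuous_on S (\<lambda>u. log_potential \<psi> (f u))"
  using assms(2) by (intro continuous_on_compose2[OF continuous_on_log_potential assms(1)]) auto

lemma entropy_mono:
  assumes "continuous_on S f" "K \<in> convex_bodies_o" "\<And>v. v \<in> S \<Longrightarrow> support_fun K v \<le> f v"
  shows "entropy K \<le> (LINT v|\<mu>. log_potential \<psi> (f v))"
  unfolding entropy_def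
proof (rule integral_mono)
  have pos: "0 < f v" if "v \<in> S" for v
    using support_fun_pos[OF assms(2) that] assms(3)[OF that] by linarith
  show "integrable \<mu> (\<lambda>v. log_potential \<psi> (support_fun K v))"
    by (intro integrable_continuous continuous_on_log_potential_compose continuous_on_support_fun assms
        support_fun_pos)
  show "integrable \<mu> (\<lambda>v. log_potential \<psi> (f v))"
    by (intro integrable_continuous continuous_on_log_potential_compose assms pos)
  show "log_potential \<psi> (support_fun K v) \<le> log_potential \<psi> (f v)" if "v \<in> space \<mu>" for v
    using that support_fun_pos[OF assms(2), of v] assms(3)[of v] unfolding space_mu
    by (intro log_potential_mono[OF psi_cont psi_pos]) auto
qed

text \<open>If the body is thin in direction \<open>v\<close>, its radial function is small on a whole cap around
  \<open>v\<close>, which makes the dual volume large. Compactness makes this uniform in \<open>v\<close>.\<close>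

lemma support_fun_lower_bound:
  obtains r where "0 < r"
    "\<And>K v. K \<in> convex_bodies_o \<Longrightarrow> dual_volume K \<le> C \<Longrightarrow> v \<in> S \<Longrightarrow> r \<le> support_fun K v"
proof -
  obtain T where T: "finite T" "T \<subseteq> S"
    "\<And>v. v \<in> S \<Longrightarrow> \<exists>w\<in>T. norm (v - w) \<le> \<epsilon>\<^sub>0 / 2 \<and> norm (v - w) \<le> 1 - \<epsilon>\<^sub>0"
    using cap_net by blast
  have "\<forall>\<^sub>F t in at_right 0. \<forall>w\<in>T. C < (LINT u : sphere_cap \<epsilon>\<^sub>0 w | sphere_measure. G t u)"
    using cap_integral_large T by (intro eventually_ball_finite) auto
  moreover have "\<forall>\<^sub>F t::real in at_right 0. 0 < t" by (simp add: eventually_at_right_less)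
  ultimately have "\<forall>\<^sub>F t in at_right 0. 0 < t \<and>
      (\<forall>w\<in>T. C < (LINT u : sphere_cap \<epsilon>\<^sub>0 w | sphere_measure. G t u))"
    by eventually_elim auto
  then obtain t where t: "0 < t"
    "\<And>w. w \<in> T \<Longrightarrow> C < (LINT u : sphere_cap \<epsilon>\<^sub>0 w | sphere_measure. G t u)"
    by (auto dest!: eventually_happens)
  show thesis
  proof (rule that[of "t * (\<epsilon>\<^sub>0 / 2)"])
    show "0 < t * (\<epsilon>\<^sub>0 / 2)" using t eps0 by simp
    fix K :: "'a set" and v assume K: "K \<in> convex_bodies_o" "dual_volume K \<le> C" and v: "v \<in> S"
    show "t * (\<epsilon>\<^sub>0 / 2) \<le> support_fun K v"
    proof (rule ccontr)
      assume small: "\<not> ?thesis"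
      obtain w where w: "w \<in> T" "norm (v - w) \<le> \<epsilon>\<^sub>0 / 2" using T(3)[OF v] by blast
      have rho: "0 < radial_fun K u" if "u \<in> S" for u by (rule radial_fun_pos[OF K(1) that])
      have rt: "radial_fun K u \<le> t" if "u \<in> sphere_cap \<epsilon>\<^sub>0 w" for u
      proof -
        have u: "u \<in> S" "\<epsilon>\<^sub>0 \<le> u \<bullet> w" using that by (auto simp: sphere_cap_def)
        have "\<epsilon>\<^sub>0 / 2 \<le> u \<bullet> v" using sphere_cap_mono[OF u(1) w(2)] u(2) by simp
        then have "radial_fun K u * (\<epsilon>\<^sub>0 / 2) \<le> radial_fun K u * (u \<bullet> v)"
          using rho[OF u(1)] by (intro mult_left_mono) auto
        also have "\<dots> \<le> support_fun K v" by (rule radial_fun_inner_le[OF K(1) u(1)])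
        also have "\<dots> \<le> t * (\<epsilon>\<^sub>0 / 2)" using small by simp
        finally show ?thesis using eps0 by simp
      qed
      have cap: "sphere_cap \<epsilon>\<^sub>0 w \<in> sets sphere_measure"
        by (intro borel_subset_in_sets_sphere_measure sphere_cap_borel)
      have "(LINT u : sphere_cap \<epsilon>\<^sub>0 w | sphere_measure. G t u) \<le> dual_volume K"
        unfolding set_lebesgue_integral_def dual_volume_def
      proof (rule integral_mono)
        have "integrable sphere_measure (\<lambda>u. G t u)"
          using t(1) by (intro integrable_continuous continuous_on_G_compose continuous_intros)
        then show "integrable sphere_measure (\<lambda>u. indicator (sphere_cap \<epsilon>\<^sub>0 w) u *\<^sub>R G t u)"
          using cap by (rule integrable_mult_indicator[rotated])
        show "integrable sphere_measure (\<lambda>u. G (radial_fun K u) u)"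
          by (intro integrable_continuous continuous_on_G_compose continuous_on_radial_fun[OF K(1)] rho)
        show "indicator (sphere_cap \<epsilon>\<^sub>0 w) u *\<^sub>R G t u \<le> G (radial_fun K u) u"
          if "u \<in> space sphere_measure" for u
          using that G_antimono[OF rho rt, of u] G_pos[OF rho, of u u]
          by (auto simp: space_sphere_measure indicator_def less_imp_le)
      qed
      with t(2)[OF w(1)] K(2) show False by linarith
    qed
  qed
qed

section \<open>Existence of a minimiser\<close>

lemma mass_pos: "0 < measure \<mu> S"
  using mu_nonzero measure_nonneg[of \<mu> S] by linarith

text \<open>The hemisphere integral depends continuously on the direction, so it has a positive minimum. The
  part of the sphere outside the cap of height \<open>\<delta>\<close> contributes at most \<open>\<delta>\<close> times the total mass;
  \<open>\<delta>\<close> makes this half of the minimum.\<close>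

lemma hemisphere_mass:
  obtains \<delta> m where "0 < \<delta>" "0 < m" "\<And>v. v \<in> S \<Longrightarrow> m \<le> measure \<mu> (sphere_cap \<delta> v)"
proof -
  define k where "k v = (LINT u|\<mu>. max (u \<bullet> v) 0)" for v :: 'a
  let ?M = "measure \<mu> S"
  have int: "integrable \<mu> (\<lambda>u. max (u \<bullet> v) 0)" for v
    by (intro integrable_continuous continuous_intros)
  have k_le: "k v - k w \<le> ?M * norm (v - w)" for v w
  proof -
    have "k v \<le> (LINT u|\<mu>. max (u \<bullet> w) 0 + norm (v - w))"
      unfolding k_def
    proof (rule integral_mono[OF int])
      show "integrable \<mu> (\<lambda>u. max (u \<bullet> w) 0 + norm (v - w))" using int by simp
      fix u assume "u \<in> space \<mu>"
      then have "u \<bullet> (v - w) \<le> norm (v - w)"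
        using norm_cauchy_schwarz[of u "v - w"] by (simp add: space_mu)
      then show "max (u \<bullet> v) 0 \<le> max (u \<bullet> w) 0 + norm (v - w)"
        by (auto simp: inner_diff_right max_def)
    qed
    also have "\<dots> = k w + ?M * norm (v - w)" using int by (simp add: k_def space_mu)
    finally show ?thesis by simp
  qed
  have "?M-lipschitz_on S k"
  proof (rule lipschitz_onI)
    show "dist (k v) (k w) \<le> ?M * dist v w" for v w
      using k_le[of v w] k_le[of w v] by (simp add: dist_norm norm_minus_commute abs_le_iff)
  qed simp
  then have "continuous_on S k" by (rule lipschitz_on_continuous_on)
  then obtain w where w: "w \<in> S" "\<And>v. v \<in> S \<Longrightarrow> k w \<le> k v"
    using continuous_attains_inf[OF compact_sphere sphere_nonempty] by blast
  have kw: "0 < k w"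
    using mu_hemisphere w(1) by (simp add: not_concentrated_on_closed_hemisphere_def k_def)
  define \<delta> where "\<delta> = k w / (2 * ?M)"
  have \<delta>: "0 < \<delta>" using kw mass_pos by (simp add: \<delta>_def)
  show thesis
  proof (rule that[of \<delta> "k w / 2"])
    show "k w / 2 \<le> measure \<mu> (sphere_cap \<delta> v)" if v: "v \<in> S" for v
    proof -
      have cap: "sphere_cap \<delta> v \<in> sets \<mu>"
        unfolding sets_mu using sphere_cap_borel[of \<delta> v] by (subst sets_restrict_space_iff) auto
      then have ic: "integrable \<mu> (indicator (sphere_cap \<delta> v) :: 'a \<Rightarrow> real)"
        by (auto simp: integrable_indicator_iff mu.emeasure_eq_measure)
      have "k v \<le> (LINT u|\<mu>. \<delta> + indicator (sphere_cap \<delta> v) u)"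
        unfolding k_def
      proof (rule integral_mono[OF int])
        show "integrable \<mu> (\<lambda>u. \<delta> + indicator (sphere_cap \<delta> v) u)" using ic by simp
        fix u assume u: "u \<in> space \<mu>"
        then have "u \<bullet> v \<le> 1" using norm_cauchy_schwarz[of u v] v by (simp add: space_mu)
        then show "max (u \<bullet> v) 0 \<le> \<delta> + indicator (sphere_cap \<delta> v) u"
          using u \<delta> by (auto simp: sphere_cap_def indicator_def space_mu)
      qed
      also have "\<dots> = \<delta> * ?M + measure \<mu> (sphere_cap \<delta> v)"
        using ic cap sphere_cap_borel(2)[of \<delta> v] by (simp add: space_mu Int_absorb2 mult.commute)
      also have "\<delta> * ?M = k w / 2" using mass_pos by (simp add: \<delta>_def)
      finally show ?thesis using w(2)[OF v] by linarith
    qed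
  qed (use \<delta> kw in auto)
qed

text \<open>A far point \<open>x\<close> of the body forces the support function to be large on a cap around the
  direction of \<open>x\<close>, and every such cap carries a fixed amount of mass.\<close>

lemma entropy_coercive:
  assumes "0 < r"
  obtains R where "0 < R"
    "\<And>K. K \<in> convex_bodies_o \<Longrightarrow> (\<And>v. v \<in> S \<Longrightarrow> r \<le> support_fun K v) \<Longrightarrow> entropy K \<le> C
      \<Longrightarrow> K \<subseteq> cball 0 R"
proof -
  obtain \<delta> m where \<delta>: "0 < \<delta>" and m: "0 < m" "\<And>v. v \<in> S \<Longrightarrow> m \<le> measure \<mu> (sphere_cap \<delta> v)"
    using hemisphere_mass by blast
  let ?M = "measure \<mu> S" and ?p = "log_potential \<psi>"
  note mono = log_potential_mono[OF psi_cont psi_pos]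
  \<comment> \<open>Raising the integrand from its lower bound to its value at \<open>T0\<close> on a single cap exceeds \<open>C\<close>.\<close>
  obtain T0 where T0: "1 \<le> T0" "max (?p r) (?p r + (C - ?p r * ?M) / m) < ?p T0"
    using log_potential_unbounded[OF psi_cont psi_pos psi_int] by blast
  have Tp: "0 < T0" "?p r < ?p T0" "C < ?p r * ?M + (?p T0 - ?p r) * m"
    using T0 m(1) by (auto simp: field_simps)
  show thesis
  proof (rule that[of "T0 / \<delta>"])
    show "0 < T0 / \<delta>" using Tp \<delta> by simp
    fix K assume K: "K \<in> convex_bodies_o" and h: "\<And>v. v \<in> S \<Longrightarrow> r \<le> support_fun K v"
      and C: "entropy K \<le> C"
    show "K \<subseteq> cball 0 (T0 / \<delta>)"
    proof (rule subsetI, rule ccontr)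
      fix x assume x: "x \<in> K" "x \<notin> cball 0 (T0 / \<delta>)"
      then have big: "T0 / \<delta> < norm x" by simp
      moreover have "0 < T0 / \<delta>" using Tp \<delta> by simp
      ultimately have "x \<noteq> 0" by auto
      define v where "v = sgn x"
      have v: "v \<in> S" using \<open>x \<noteq> 0\<close> by (simp add: v_def norm_sgn)
      have cap: "sphere_cap \<delta> v \<in> sets \<mu>"
        unfolding sets_mu using sphere_cap_borel[of \<delta> v] by (subst sets_restrict_space_iff) auto
      then have ic: "integrable \<mu> (indicator (sphere_cap \<delta> v) :: 'a \<Rightarrow> real)"
        by (auto simp: integrable_indicator_iff mu.emeasure_eq_measure)
      have "(LINT u|\<mu>. ?p r + (?p T0 - ?p r) * indicator (sphere_cap \<delta> v) u) \<le> entropy K"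
        unfolding entropy_def
      proof (rule integral_mono)
        show "integrable \<mu> (\<lambda>u. ?p r + (?p T0 - ?p r) * indicator (sphere_cap \<delta> v) u)"
          using ic by simp
        show "integrable \<mu> (\<lambda>u. ?p (support_fun K u))"
          by (intro integrable_continuous continuous_on_log_potential_compose
              continuous_on_support_fun[OF K] support_fun_pos[OF K])
        fix u assume "u \<in> space \<mu>"
        then have u: "u \<in> S" by (simp add: space_mu)
        have "?p r \<le> ?p (support_fun K u)" using mono[OF _ \<open>0 < r\<close> h[OF u]] by blast
        moreover have "?p T0 \<le> ?p (support_fun K u)" if "u \<in> sphere_cap \<delta> v"
        proof (rule mono)
          have "T0 / \<delta> * \<delta> \<le> norm x * (u \<bullet> v)"
            using big that \<delta> Tp by (intro mult_mono) (auto simp: sphere_cap_def)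
          also have "\<dots> = x \<bullet> u" using \<open>x \<noteq> 0\<close> by (simp add: v_def sgn_div_norm inner_commute)
          also have "\<dots> \<le> support_fun K u" by (rule inner_le_support_fun[OF convex_bodyD(1)[OF K] x(1)])
          finally show "T0 \<le> support_fun K u" using \<delta> by simp
        qed (use Tp in auto)
        ultimately show "?p r + (?p T0 - ?p r) * indicator (sphere_cap \<delta> v) u \<le> ?p (support_fun K u)"
          by (auto simp: indicator_def)
      qed
      also have "(LINT u|\<mu>. ?p r + (?p T0 - ?p r) * indicator (sphere_cap \<delta> v) u)
          = ?p r * ?M + (?p T0 - ?p r) * measure \<mu> (sphere_cap \<delta> v)"
        using ic cap sphere_cap_borel(2)[of \<delta> v] by (simp add: space_mu Int_absorb2 mult.commute)
      also have "\<dots> \<ge> ?p r * ?M + (?p T0 - ?p r) * m"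
        using m(2)[OF v] Tp by (intro add_left_mono mult_left_mono) auto
      finally show False using C Tp(3) by linarith
    qed
  qed
qed

text \<open>The approximating bodies lie in slightly enlarged copies of the Wulff shape, so by monotonicity the
  dual volumes of these copies are at most \<open>C\<close>. Dominated convergence removes the enlargement.\<close>

lemma dual_volume_wulff_shape_le:
  fixes K :: "nat \<Rightarrow> 'a set"
  assumes f: "continuous_on S f" "\<And>v. v \<in> S \<Longrightarrow> 0 < f v"
    and K: "\<And>n. K n \<in> convex_bodies_o" "\<And>n. dual_volume (K n) \<le> C"
    and approx: "\<And>e. 0 < e \<Longrightarrow> \<exists>n. \<forall>v\<in>S. support_fun (K n) v \<le> (1 + e) * f v"
  shows "dual_volume (wulff_shape f) \<le> C"
proof -
  let ?L = "wulff_shape f"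
  have L: "?L \<in> convex_bodies_o" by (rule wulff_shape_convex_body[OF f])
  define c :: "nat \<Rightarrow> real" where "c i = 1 + 1 / real (Suc i)" for i
  have c: "1 < c i" for i by (simp add: c_def)
  have rho: "0 < radial_fun ?L u" if "u \<in> S" for u by (rule radial_fun_pos[OF L that])
  have int: "integrable sphere_measure (\<lambda>u. G (a * radial_fun ?L u) u)" if "0 < a" for a
    by (intro integrable_continuous continuous_on_G_compose continuous_intros continuous_on_radial_fun[OF L])
      (use rho that in auto)
  have le: "(LINT u|sphere_measure. G (c i * radial_fun ?L u) u) \<le> C" for i
  proof -
    obtain n where n: "\<forall>v\<in>S. support_fun (K n) v \<le> c i * f v"
      using approx[of "1 / real (Suc i)"] unfolding c_def by fastforce
    have up: "radial_fun (K n) u \<le> c i * radial_fun ?L u" if u: "u \<in> S" for u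
    proof -
      have "(radial_fun (K n) u / c i) *\<^sub>R u \<in> ?L"
        unfolding wulff_shape_def
      proof (intro CollectI ballI)
        fix v assume v: "v \<in> S"
        have "radial_fun (K n) u * (u \<bullet> v) \<le> c i * f v"
          using radial_fun_inner_le[OF K(1) u, of n v] n[rule_format, OF v] by linarith
        then show "(radial_fun (K n) u / c i) *\<^sub>R u \<bullet> v \<le> f v"
          using c[of i] by (simp add: field_simps)
      qed
      then have "radial_fun (K n) u / c i \<le> radial_fun ?L u" by (rule radial_fun_greatest[OF L u])
      then show ?thesis using c[of i] by (simp add: field_simps)
    qed
    have "(LINT u|sphere_measure. G (c i * radial_fun ?L u) u) \<le> dual_volume (K n)"
      unfolding dual_volume_def
    proof (rule integral_mono)
      show "integrable sphere_measure (\<lambda>u. G (c i * radial_fun ?L u) u)" using c[of i] by (intro int) simp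
      show "integrable sphere_measure (\<lambda>u. G (radial_fun (K n) u) u)"
        by (intro integrable_continuous continuous_on_G_compose continuous_on_radial_fun K radial_fun_pos)
      show "G (c i * radial_fun ?L u) u \<le> G (radial_fun (K n) u) u" if "u \<in> space sphere_measure" for u
        using that unfolding space_sphere_measure by (intro G_antimono up radial_fun_pos K)
    qed
    then show ?thesis using K(2)[of n] by linarith
  qed
  have "(\<lambda>i. LINT u|sphere_measure. G (c i * radial_fun ?L u) u) \<longlonglongrightarrow> dual_volume ?L"
    unfolding dual_volume_def
  proof (rule integral_dominated_convergence[where w = "\<lambda>u. G (radial_fun ?L u) u"])
    show "(\<lambda>u. G (radial_fun ?L u) u) \<in> borel_measurable sphere_measure"
      "integrable sphere_measure (\<lambda>u. G (radial_fun ?L u) u)"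
      using int[of 1] by simp_all
    show "(\<lambda>u. G (c i * radial_fun ?L u) u) \<in> borel_measurable sphere_measure" for i
      using int[of "c i"] c[of i] by simp
    show "AE u in sphere_measure. (\<lambda>i. G (c i * radial_fun ?L u) u) \<longlonglongrightarrow> G (radial_fun ?L u) u"
    proof (rule AE_I2)
      fix u :: 'a assume "u \<in> space sphere_measure"
      then have u: "u \<in> S" by (simp add: space_sphere_measure)
      have "c \<longlonglongrightarrow> 1 + 0" unfolding c_def by (intro tendsto_add tendsto_const LIMSEQ_Suc lim_1_over_n)
      then have "(\<lambda>i. c i * radial_fun ?L u) \<longlonglongrightarrow> 1 * radial_fun ?L u" by (intro tendsto_mult_right) simp
      moreover have "isCont (\<lambda>t. G t u) (radial_fun ?L u)" by (rule DERIV_isCont[OF DERIV_G[OF rho[OF u] u]])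
      ultimately show "(\<lambda>i. G (c i * radial_fun ?L u) u) \<longlonglongrightarrow> G (radial_fun ?L u) u"
        using isCont_tendsto_compose[of "radial_fun ?L u" "\<lambda>t. G t u"] by simp
    qed
    show "AE u in sphere_measure. norm (G (c i * radial_fun ?L u) u) \<le> G (radial_fun ?L u) u" for i
    proof (rule AE_I2)
      fix u :: 'a assume "u \<in> space sphere_measure"
      then have u: "u \<in> S" by (simp add: space_sphere_measure)
      have le: "radial_fun ?L u \<le> c i * radial_fun ?L u"
        using mult_right_mono[of 1 "c i" "radial_fun ?L u"] c[of i] rho[OF u] by simp
      have "0 < G (c i * radial_fun ?L u) u" using c[of i] rho[OF u] by (intro G_pos u) simp
      then show "norm (G (c i * radial_fun ?L u) u) \<le> G (radial_fun ?L u) u"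
        using G_antimono[OF rho[OF u] le u] by simp
    qed
  qed
  then show ?thesis by (rule LIMSEQ_le_const2) (use le in auto)
qed

text \<open>Direct method. Along a minimising sequence with dual volume at most that of the unit ball, the
  support functions are bounded above and below and equi-Lipschitz. Their limit need not be known to
  be a support function: its Wulff shape is admissible, and its support function lies below the
  limit, so its entropy is at most the infimum.\<close>

lemma entropy_minimiser_exists:
  obtains K where "K \<in> convex_bodies_o"
    "\<And>L. L \<in> convex_bodies_o \<Longrightarrow> dual_volume L \<le> dual_volume K \<Longrightarrow> entropy K \<le> entropy L"
proof -
  have ball: "cball 0 1 \<in> (convex_bodies_o :: 'a set set)" by (simp add: convex_bodies_o_def)
  define C where "C = dual_volume (cball 0 1)"
  define A where "A = {K \<in> convex_bodies_o. dual_volume K \<le> C}"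
  have ballA: "cball 0 1 \<in> A" using ball by (simp add: A_def C_def)
  obtain r where r: "0 < r" "\<And>K v. K \<in> convex_bodies_o \<Longrightarrow> dual_volume K \<le> C \<Longrightarrow> v \<in> S \<Longrightarrow> r \<le> support_fun K v"
    using support_fun_lower_bound by blast
  let ?p = "log_potential \<psi>"
  have bdd: "?p r * measure \<mu> S \<le> entropy K" if "K \<in> A" for K
  proof -
    have K: "K \<in> convex_bodies_o" "dual_volume K \<le> C" using that by (auto simp: A_def)
    have "(LINT v|\<mu>. ?p r) \<le> entropy K"
      unfolding entropy_def
    proof (rule integral_mono)
      show "integrable \<mu> (\<lambda>v. ?p (support_fun K v))"
        by (intro integrable_continuous continuous_on_log_potential_compose
            continuous_on_support_fun[OF K(1)] support_fun_pos[OF K(1)])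
      show "?p r \<le> ?p (support_fun K v)" if "v \<in> space \<mu>" for v
        using that r K unfolding space_mu by (intro log_potential_mono[OF psi_cont psi_pos])
    qed simp
    then show ?thesis by (simp add: space_mu mult.commute)
  qed
  define I where "I = Inf (entropy ` A)"
  have bb: "bdd_below (entropy ` A)" using bdd by (auto simp: bdd_below_def)
  have I_le: "I \<le> entropy K" if "K \<in> A" for K
    unfolding I_def using that bb by (intro cINF_lower)
  have "\<exists>K\<in>A. entropy K < I + 1 / real (Suc n)" for n
    using cINF_less_iff[OF _ bb, of "I + 1 / real (Suc n)"] ballA by (auto simp: I_def)
  then obtain K where K: "\<And>n. K n \<in> A" "\<And>n. entropy (K n) < I + 1 / real (Suc n)" by metis
  have Kb: "K n \<in> convex_bodies_o" "dual_volume (K n) \<le> C" for n using K(1)[of n] by (auto simp: A_def)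
  have Kr: "r \<le> support_fun (K n) v" if "v \<in> S" for n v using r(2)[OF Kb that] .
  obtain R where R: "0 < R" "\<And>K. K \<in> convex_bodies_o \<Longrightarrow> (\<And>v. v \<in> S \<Longrightarrow> r \<le> support_fun K v)
      \<Longrightarrow> entropy K \<le> I + 1 \<Longrightarrow> K \<subseteq> cball 0 R"
    using entropy_coercive[OF r(1)] by blast
  have KR: "K n \<subseteq> cball 0 R" for n
  proof (rule R(2)[OF Kb(1) Kr])
    have "1 / real (Suc n) \<le> 1" by simp
    then show "entropy (K n) \<le> I + 1" using K(2)[of n] by linarith
  qed
  have KS: "support_fun (K n) v \<le> R" if "v \<in> S" for n v
    using that by (intro support_fun_upper convex_bodyD[OF Kb(1)] KR) auto
  obtain f k where f: "continuous_on S f" "strict_mono (k :: nat \<Rightarrow> nat)"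
    and lim: "\<And>e. 0 < e \<Longrightarrow> \<exists>N. \<forall>n v. N \<le> n \<and> v \<in> S \<longrightarrow> norm (support_fun (K (k n)) v - f v) < e"
  proof (rule Arzela_Ascoli[of S "\<lambda>n. support_fun (K n)" R])
    show "norm (support_fun (K n) v) \<le> R" if "v \<in> S" for n v
      using KS[OF that, of n] Kr[OF that, of n] r(1) by simp
    show "\<exists>d>0. \<forall>n w. w \<in> S \<and> norm (v - w) < d \<longrightarrow> norm (support_fun (K n) v - support_fun (K n) w) < e"
      if "v \<in> S" "0 < e" for v e
    proof (intro exI[of _ "e / R"] conjI allI impI)
      fix n w assume w: "w \<in> S \<and> norm (v - w) < e / R"
      have "support_fun (K n) v - support_fun (K n) w \<le> R * norm (v - w)"
        "support_fun (K n) w - support_fun (K n) v \<le> R * norm (w - v)"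
        by (intro support_fun_diff_le convex_bodyD[OF Kb(1)] KR)+
      moreover have "R * norm (v - w) < e" using w R(1) by (simp add: field_simps)
      ultimately show "norm (support_fun (K n) v - support_fun (K n) w) < e"
        by (simp add: norm_minus_commute abs_less_iff)
    qed (use R(1) that in auto)
  qed auto
  have pt: "(\<lambda>n. support_fun (K (k n)) v) \<longlonglongrightarrow> f v" if "v \<in> S" for v
    unfolding LIMSEQ_iff using lim that by blast
  have fr: "r \<le> f v" if "v \<in> S" for v
    by (rule LIMSEQ_le_const[OF pt[OF that]]) (use Kr that in auto)
  have fpos: "0 < f v" if "v \<in> S" for v using fr[OF that] r(1) by linarith
  let ?L = "wulff_shape f"
  have L: "?L \<in> convex_bodies_o" by (rule wulff_shape_convex_body[OF f(1) fpos])
  have volL: "dual_volume ?L \<le> C"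
  proof (rule dual_volume_wulff_shape_le[OF f(1) fpos, of "\<lambda>n. K (k n)"])
    fix e :: real assume "0 < e"
    then obtain N where N: "\<And>n v. N \<le> n \<and> v \<in> S \<Longrightarrow> norm (support_fun (K (k n)) v - f v) < e * r"
      using lim[of "e * r"] r(1) by auto
    have "support_fun (K (k N)) v \<le> (1 + e) * f v" if v: "v \<in> S" for v
    proof -
      have "support_fun (K (k N)) v - f v < e * r" using N[of N v] v by simp
      also have "\<dots> \<le> e * f v" using fr[OF v] \<open>0 < e\<close> by (intro mult_left_mono) auto
      finally show ?thesis by (simp add: algebra_simps)
    qed
    then show "\<exists>n. \<forall>v\<in>S. support_fun (K (k n)) v \<le> (1 + e) * f v" by blast
  qed (use Kb in auto)
  have "entropy ?L \<le> (LINT v|\<mu>. ?p (f v))"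
    by (intro entropy_mono f(1) L support_fun_wulff_shape_le)
  also have "\<dots> \<le> I"
  proof (rule LIMSEQ_le)
    show "(\<lambda>n. entropy (K (k n))) \<longlonglongrightarrow> (LINT v|\<mu>. ?p (f v))"
      unfolding entropy_def
    proof (rule integral_dominated_convergence[where w = "\<lambda>_. max \<bar>?p r\<bar> \<bar>?p R\<bar>"])
      show "(\<lambda>v. ?p (f v)) \<in> borel_measurable \<mu>"
        by (intro borel_measurable_integrable integrable_continuous continuous_on_log_potential_compose f(1) fpos)
      show "(\<lambda>v. ?p (support_fun (K (k n)) v)) \<in> borel_measurable \<mu>" for n
        by (intro borel_measurable_integrable integrable_continuous continuous_on_log_potential_compose
            continuous_on_support_fun support_fun_pos Kb)
      show "AE v in \<mu>. (\<lambda>n. ?p (support_fun (K (k n)) v)) \<longlonglongrightarrow> ?p (f v)"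
        using pt fpos unfolding space_mu[symmetric]
        by (intro AE_I2 isCont_tendsto_compose[OF DERIV_isCont[OF DERIV_log_potential[OF psi_cont]]])
      show "AE v in \<mu>. norm (?p (support_fun (K (k n)) v)) \<le> max \<bar>?p r\<bar> \<bar>?p R\<bar>" for n
      proof (rule AE_I2)
        fix v assume "v \<in> space \<mu>"
        then have v: "v \<in> S" by (simp add: space_mu)
        have pos: "0 < support_fun (K (k n)) v" by (rule support_fun_pos[OF Kb(1) v])
        have "?p r \<le> ?p (support_fun (K (k n)) v)" "?p (support_fun (K (k n)) v) \<le> ?p R"
          by (intro log_potential_mono[OF psi_cont psi_pos] r(1) Kr KS pos v; assumption)+
        then show "norm (?p (support_fun (K (k n)) v)) \<le> max \<bar>?p r\<bar> \<bar>?p R\<bar>"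
          unfolding real_norm_def by linarith
      qed
    qed simp
    have "(\<lambda>n. I + 1 / real (Suc (k n))) \<longlonglongrightarrow> I + 0"
      using LIMSEQ_subseq_LIMSEQ[OF LIMSEQ_Suc[OF lim_1_over_n] f(2)]
      by (intro tendsto_add tendsto_const) (simp add: o_def)
    then show "(\<lambda>n. I + 1 / real (Suc (k n))) \<longlonglongrightarrow> I" by simp
    show "\<exists>N. \<forall>n\<ge>N. entropy (K (k n)) \<le> I + 1 / real (Suc (k n))"
      using K(2) by (auto intro: less_imp_le)
  qed
  finally have "entropy ?L \<le> I" .
  show thesis
  proof (rule that[OF L])
    fix M assume "M \<in> convex_bodies_o" "dual_volume M \<le> dual_volume ?L"
    then have "M \<in> A" using volL by (simp add: A_def)
    then show "entropy ?L \<le> entropy M" using I_le \<open>entropy ?L \<le> I\<close> by (blast intro: order_trans)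
  qed
qed

end

section \<open>The Euler-Lagrange equation\<close>

lemma DERIV_scaled_exp: "((\<lambda>s. a * exp s) has_real_derivative a * exp s) (at (s::real))"
  by (auto intro!: derivative_eq_intros)

lemma nonneg_if_perturbed_nonneg:
  fixes x y :: real
  assumes "\<And>e. 0 < e \<Longrightarrow> 0 \<le> x + e * y"
  shows "0 \<le> x"
proof (rule ccontr)
  assume "\<not> 0 \<le> x"
  define e where "e = - x / (2 * (\<bar>y\<bar> + 1))"
  have "0 < e" using \<open>\<not> 0 \<le> x\<close> by (simp add: e_def field_simps)
  have "e * y \<le> e * (\<bar>y\<bar> + 1)" using \<open>0 < e\<close> by (intro mult_left_mono) auto
  also have "\<dots> = - x / 2" by (simp add: e_def field_simps)
  finally show False using assms[OF \<open>0 < e\<close>] \<open>\<not> 0 \<le> x\<close> by linarith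
qed

context dual_Orlicz_problem
begin

lemma measurable_compose_normal_choice:
  fixes f :: "'a \<Rightarrow> real"
  assumes K: "K \<in> convex_bodies_o" and f: "continuous_on S f"
  shows "(\<lambda>u. f (normal_choice K u)) \<in> borel_measurable sphere_measure"
proof -
  have "normal_choice K \<in> measurable sphere_measure (restrict_space borel S)"
    using normal_choice_in_sphere[OF K]
    by (intro measurable_restrict_space2 measurable_normal_choice[OF K emeasure_sphere_finite])
      (auto simp: space_sphere_measure)
  then show ?thesis
    using borel_measurable_continuous_on_restrict[OF f] by (rule measurable_compose)
qed

lemma integrable_mult_compose_normal_choice:
  fixes f k :: "'a \<Rightarrow> real"
  assumes K: "K \<in> convex_bodies_o" and f: "continuous_on S f" and k: "continuous_on S k"
  shows "integrable sphere_measure (\<lambda>u. k u * f (normal_choice K u))"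
proof -
  obtain B where B: "\<And>u. u \<in> S \<Longrightarrow> \<bar>f u\<bar> \<le> B" using continuous_on_sphere_bounded[OF f] by blast
  show ?thesis
  proof (rule Bochner_Integration.integrable_bound)
    show "integrable sphere_measure (\<lambda>u. B * k u)" using integrable_continuous(2)[OF k] by simp
    show "AE u in sphere_measure. norm (k u * f (normal_choice K u)) \<le> norm (B * k u)"
    proof (rule AE_I2)
      fix u :: 'a assume "u \<in> space sphere_measure"
      then have "\<bar>f (normal_choice K u)\<bar> \<le> B"
        using B normal_choice_in_sphere[OF K] unfolding space_sphere_measure by blast
      then have "\<bar>k u\<bar> * \<bar>f (normal_choice K u)\<bar> \<le> \<bar>k u\<bar> * \<bar>B\<bar>" by (intro mult_left_mono) auto
      then show "norm (k u * f (normal_choice K u)) \<le> norm (B * k u)" by (simp add: abs_mult mult.commute)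
    qed
  qed (intro borel_measurable_times measurable_compose_normal_choice[OF K f]
      borel_measurable_integrable integrable_continuous k)
qed

definition radial_density :: "'a set \<Rightarrow> 'a \<Rightarrow> real" where
  "radial_density K u = - (radial_fun K u * partial_t G (radial_fun K u) u)"

lemma
  assumes K: "K \<in> convex_bodies_o"
  shows continuous_on_radial_density: "continuous_on S (radial_density K)"
    and radial_density_pos: "u \<in> S \<Longrightarrow> 0 < radial_density K u"
proof -
  show "continuous_on S (radial_density K)"
    unfolding radial_density_def
    by (intro continuous_intros continuous_on_radial_fun[OF K] continuous_on_G_compose radial_fun_pos[OF K])
  show "0 < radial_density K u" if "u \<in> S"
    using radial_fun_pos[OF K that] Gt_neg[OF radial_fun_pos[OF K that] that]
    by (simp add: radial_density_def mult_pos_neg)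
qed

lemma continuous_on_exp_scaling:
  fixes f :: "'a \<Rightarrow> real"
  assumes f: "continuous_on S f" "\<And>u. u \<in> S \<Longrightarrow> 0 < f u"
  shows "continuous_on ({-Q..Q} \<times> S) (\<lambda>x. f (snd x) * exp (fst x))"
    "(\<lambda>x. f (snd x) * exp (fst x)) ` ({-Q..Q} \<times> S) \<subseteq> {0<..}"
proof -
  have "continuous_on ({-Q..Q} \<times> S) (\<lambda>x. f (snd x))"
    by (rule continuous_on_compose2[OF f(1) continuous_on_snd[OF continuous_on_id]]) auto
  moreover have "continuous_on ({-Q..Q} \<times> S) (\<lambda>x. exp (fst x))" by (intro continuous_intros)
  ultimately show "continuous_on ({-Q..Q} \<times> S) (\<lambda>x. f (snd x) * exp (fst x))"
    by (rule continuous_on_mult)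
  show "(\<lambda>x. f (snd x) * exp (fst x)) ` ({-Q..Q} \<times> S) \<subseteq> {0<..}"
  proof (rule image_subsetI)
    fix x assume "x \<in> {-Q..Q} \<times> S"
    then have "snd x \<in> S" by auto
    then show "f (snd x) * exp (fst x) \<in> {0<..}" using f(2)[of "snd x"] by simp
  qed
qed

text \<open>With \<open>q\<close> the logarithmic rate, the radial function of the perturbed body is exactly
  \<open>radial_fun K u * exp (t * q)\<close>, and \<open>q\<close> converges almost everywhere by the envelope theorem.\<close>

lemma dual_volume_variation:
  assumes K: "K \<in> convex_bodies_o" and g: "continuous_on S g"
    and t: "\<And>n. 0 < t n" "\<And>n. t n \<le> 1" "t \<longlonglongrightarrow> 0"
  shows "(\<lambda>n. (dual_volume (log_perturbation K g (t n)) - dual_volume K) / t n)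
    \<longlonglongrightarrow> - (LINT u|sphere_measure. radial_density K u * g (normal_choice K u))"
proof -
  define F where "F s u = G (radial_fun K u * exp s) u" for s u
  define F' where "F' s u = radial_fun K u * exp s * partial_t G (radial_fun K u * exp s) u" for s u
  obtain Q where Q: "\<And>v. v \<in> S \<Longrightarrow> \<bar>g v\<bar> \<le> Q" using continuous_on_sphere_bounded[OF g] by blast
  have rho: "0 < radial_fun K u" if "u \<in> S" for u by (rule radial_fun_pos[OF K that])
  note sc = continuous_on_exp_scaling[OF continuous_on_radial_fun[OF K] rho, of Q]
  have "continuous_on ({-Q..Q} \<times> S) (\<lambda>x. partial_t G (radial_fun K (snd x) * exp (fst x)) (snd x))"
    using continuous_on_compose2[OF Gt_cont, of "{-Q..Q} \<times> S" "\<lambda>x. (radial_fun K (snd x) * exp (fst x), snd x)"]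
      sc by (force intro!: continuous_intros)
  then have "continuous_on ({-Q..Q} \<times> S) (\<lambda>x. F' (fst x) (snd x))"
    unfolding F'_def by (intro continuous_on_mult sc(1)[unfolded mult.assoc])
  then have "bounded ((\<lambda>x. F' (fst x) (snd x)) ` ({-Q..Q} \<times> S))"
    by (intro compact_imp_bounded compact_continuous_image compact_Times compact_Icc compact_sphere)
  then obtain B where B: "\<forall>x\<in>{-Q..Q} \<times> S. \<bar>F' (fst x) (snd x)\<bar> \<le> B" by (auto simp: bounded_iff)
  have Fq: "F (t n * log_radial_rate K g (t n) u) u = G (radial_fun (log_perturbation K g (t n)) u) u"
    if "u \<in> S" for n u
    unfolding F_def radial_fun_log_perturbation[OF K g t(1) that] ..
  have F0: "F 0 u = G (radial_fun K u) u" for u by (simp add: F_def)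
  have F'0: "F' 0 u = - radial_density K u" for u by (simp add: F'_def radial_density_def)
  have intG: "integrable sphere_measure (\<lambda>u. G (radial_fun L u) u)" if "L \<in> convex_bodies_o" for L
    by (intro integrable_continuous continuous_on_G_compose continuous_on_radial_fun radial_fun_pos that)
  have "(\<lambda>n. ((LINT u|sphere_measure. F (t n * log_radial_rate K g (t n) u) u) - (LINT u|sphere_measure. F 0 u)) / t n)
      \<longlonglongrightarrow> (LINT u|sphere_measure. F' 0 u * g (normal_choice K u))"
  proof (rule integral_difference_quotient_tendsto[OF sigma.finite_measure_axioms t])
    show "(\<lambda>u. F (t n * log_radial_rate K g (t n) u) u) \<in> borel_measurable sphere_measure" for n
      by (subst measurable_cong[OF Fq])
        (auto simp: space_sphere_measure intro!: borel_measurable_integrable intG log_perturbation_convex_body[OF K g])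
    show "(\<lambda>u. F' 0 u * g (normal_choice K u)) \<in> borel_measurable sphere_measure"
      unfolding F'0
      by (intro borel_measurable_integrable integrable_mult_compose_normal_choice[OF K g] continuous_intros
          continuous_on_radial_density[OF K])
    show "integrable sphere_measure (F 0)" using intG[OF K] by (simp add: F_def[abs_def])
    show "\<bar>log_radial_rate K g (t n) u\<bar> \<le> Q" if "u \<in> space sphere_measure" for n u
      using that unfolding space_sphere_measure by (intro abs_log_radial_rate_le[OF K g Q t(1)])
    have "AE u in sphere_measure. u \<notin> singular_directions K"
      by (rule AE_not_in[OF singular_directions_null[OF K emeasure_sphere_finite]])
    then show "AE u in sphere_measure. (\<lambda>n. log_radial_rate K g (t n) u) \<longlonglongrightarrow> g (normal_choice K u)"
      by (rule AE_mp) (auto intro!: AE_I2 log_radial_rate_tendsto[OF K g t(1,3)] simp: space_sphere_measure)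
    fix s u assume u: "u \<in> space (sphere_measure :: 'a measure)" and s: "\<bar>s\<bar> \<le> Q"
    then have u: "u \<in> S" by (simp add: space_sphere_measure)
    show "\<bar>F' s u\<bar> \<le> B" using B u s by force
    have "0 < radial_fun K u * exp s" using rho[OF u] by simp
    from DERIV_chain2[where g = "\<lambda>s. radial_fun K u * exp s", OF DERIV_G[OF this u] DERIV_scaled_exp]
    show "((\<lambda>s. F s u) has_real_derivative F' s u) (at s)"
      unfolding F_def F'_def by (simp only: mult.commute)
  qed
  moreover have "(LINT u|sphere_measure. F (t n * log_radial_rate K g (t n) u) u)
      = dual_volume (log_perturbation K g (t n))" for n
    unfolding dual_volume_def by (rule Bochner_Integration.integral_cong) (auto simp: space_sphere_measure Fq)
  ultimately show ?thesis by (simp add: F0 F'0 dual_volume_def)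
qed

lemma entropy_variation:
  assumes K: "K \<in> convex_bodies_o" and g: "continuous_on S g"
    and t: "\<And>n. 0 < t n" "\<And>n. t n \<le> 1" "t \<longlonglongrightarrow> 0"
  shows "(\<lambda>n. ((LINT v|\<mu>. log_potential \<psi> (support_fun K v * exp (t n * g v))) - entropy K) / t n)
    \<longlonglongrightarrow> (LINT v|\<mu>. \<psi> (support_fun K v) * g v)"
proof -
  define F where "F s v = log_potential \<psi> (support_fun K v * exp s)" for s v
  define F' where "F' s v = \<psi> (support_fun K v * exp s)" for s v
  obtain Q where Q: "\<And>v. v \<in> S \<Longrightarrow> \<bar>g v\<bar> \<le> Q" using continuous_on_sphere_bounded[OF g] by blast
  have h: "0 < support_fun K v" if "v \<in> S" for v by (rule support_fun_pos[OF K that])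
  note sc = continuous_on_exp_scaling[OF continuous_on_support_fun[OF K] h, of Q]
  have "continuous_on ({-Q..Q} \<times> S) (\<lambda>x. F' (fst x) (snd x))"
    unfolding F'_def by (rule continuous_on_compose2[OF psi_cont sc])
  then have "bounded ((\<lambda>x. F' (fst x) (snd x)) ` ({-Q..Q} \<times> S))"
    by (intro compact_imp_bounded compact_continuous_image compact_Times compact_Icc compact_sphere)
  then obtain B where B: "\<forall>x\<in>{-Q..Q} \<times> S. \<bar>F' (fst x) (snd x)\<bar> \<le> B" by (auto simp: bounded_iff)
  have psih: "continuous_on S (\<lambda>v. \<psi> (support_fun K v))"
    by (rule continuous_on_compose2[OF psi_cont continuous_on_support_fun[OF K]]) (use h in auto)
  have "(\<lambda>n. ((LINT v|\<mu>. F (t n * g v) v) - (LINT v|\<mu>. F 0 v)) / t n) \<longlonglongrightarrow> (LINT v|\<mu>. F' 0 v * g v)"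
  proof (rule integral_difference_quotient_tendsto[where q = "\<lambda>n. g", OF mu.finite_measure_axioms t])
    show "(\<lambda>v. F (t n * g v) v) \<in> borel_measurable \<mu>" for n
      unfolding F_def
      by (intro borel_measurable_integrable integrable_continuous continuous_on_log_potential_compose
          continuous_intros continuous_on_support_fun[OF K] g) (simp add: h)
    show "(\<lambda>v. F' 0 v * g v) \<in> borel_measurable \<mu>"
      unfolding F'_def using psih g
      by (intro borel_measurable_integrable integrable_continuous continuous_intros) simp_all
    show "integrable \<mu> (F 0)"
      unfolding F_def[abs_def]
      by (intro integrable_continuous continuous_on_log_potential_compose
          continuous_intros continuous_on_support_fun[OF K]) (simp add: h)
    show "\<bar>g v\<bar> \<le> Q" if "v \<in> space \<mu>" for v using Q that by (simp add: space_mu)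
    show "AE v in \<mu>. (\<lambda>n. g v) \<longlonglongrightarrow> g v" by simp
    fix s v assume v: "v \<in> space \<mu>" and s: "\<bar>s\<bar> \<le> Q"
    then have v: "v \<in> S" by (simp add: space_mu)
    show "\<bar>F' s v\<bar> \<le> B" using B v s by force
    have pos: "0 < support_fun K v * exp s" using h[OF v] by simp
    from DERIV_chain2[where g = "\<lambda>s. support_fun K v * exp s",
        OF DERIV_log_potential[OF psi_cont pos] DERIV_scaled_exp]
    show "((\<lambda>s. F s v) has_real_derivative F' s v) (at s)"
    proof -
      have "\<psi> (support_fun K v * exp s) / (support_fun K v * exp s) * (support_fun K v * exp s)
          = \<psi> (support_fun K v * exp s)"
        using h[OF v] by simp
      with \<open>((\<lambda>s. log_potential \<psi> (support_fun K v * exp s)) has_real_derivative _) (at s)\<close>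
      show ?thesis unfolding F_def F'_def by (simp only:)
    qed
  qed
  then show ?thesis by (simp add: F_def F'_def entropy_def)
qed

text \<open>The rate at which the dual volume decreases under the logarithmic perturbation by \<open>g\<close>.\<close>

definition dual_volume_rate :: "'a set \<Rightarrow> ('a \<Rightarrow> real) \<Rightarrow> real" where
  "dual_volume_rate K g = (LINT u|sphere_measure. radial_density K u * g (normal_choice K u))"

definition entropy_rate :: "'a set \<Rightarrow> ('a \<Rightarrow> real) \<Rightarrow> real" where
  "entropy_rate K g = (LINT v|\<mu>. \<psi> (support_fun K v) * g v)"

lemma continuous_on_psi_support:
  assumes "K \<in> convex_bodies_o"
  shows "continuous_on S (\<lambda>v. \<psi> (support_fun K v))"
  by (rule continuous_on_compose2[OF psi_cont continuous_on_support_fun[OF assms]])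
    (use support_fun_pos[OF assms] in auto)

lemma
  assumes K: "K \<in> convex_bodies_o" and g: "continuous_on S g"
  shows dual_volume_rate_affine: "dual_volume_rate K (\<lambda>v. a * g v + b) = a * dual_volume_rate K g + b * dual_volume_rate K (\<lambda>_. 1)"
    and entropy_rate_affine: "entropy_rate K (\<lambda>v. a * g v + b) = a * entropy_rate K g + b * entropy_rate K (\<lambda>_. 1)"
proof -
  let ?w = "radial_density K" and ?n = "normal_choice K" and ?p = "\<lambda>v. \<psi> (support_fun K v)"
  have i: "integrable sphere_measure (\<lambda>u. ?w u * g (?n u))" "integrable sphere_measure ?w"
    by (intro integrable_mult_compose_normal_choice K g continuous_on_radial_density integrable_continuous)+
  have "dual_volume_rate K (\<lambda>v. a * g v + b) = (LINT u|sphere_measure. a * (?w u * g (?n u)) + b * ?w u)"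
    unfolding dual_volume_rate_def by (intro Bochner_Integration.integral_cong) (auto simp: algebra_simps)
  then show "dual_volume_rate K (\<lambda>v. a * g v + b) = a * dual_volume_rate K g + b * dual_volume_rate K (\<lambda>_. 1)"
    using i by (simp add: dual_volume_rate_def)
  have j: "integrable \<mu> (\<lambda>v. ?p v * g v)" "integrable \<mu> ?p"
    by (intro integrable_continuous continuous_intros continuous_on_psi_support[OF K] g)+
  have "entropy_rate K (\<lambda>v. a * g v + b) = (LINT v|\<mu>. a * (?p v * g v) + b * ?p v)"
    unfolding entropy_rate_def by (intro Bochner_Integration.integral_cong) (auto simp: algebra_simps)
  then show "entropy_rate K (\<lambda>v. a * g v + b) = a * entropy_rate K g + b * entropy_rate K (\<lambda>_. 1)"
    using j by (simp add: entropy_rate_def)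
qed

lemma dual_volume_rate_one_pos:
  assumes K: "K \<in> convex_bodies_o"
  shows "0 < dual_volume_rate K (\<lambda>_. 1)"
proof -
  obtain w where w: "w \<in> S" "\<And>u. u \<in> S \<Longrightarrow> radial_density K w \<le> radial_density K u"
    using continuous_attains_inf[OF compact_sphere sphere_nonempty continuous_on_radial_density[OF K]] by blast
  have "0 < radial_density K w * measure sphere_measure S"
    using radial_density_pos[OF K w(1)] measure_sphere_pos by simp
  also have "\<dots> = (LINT u::'a|sphere_measure. radial_density K w)"
    by (simp add: space_sphere_measure mult.commute)
  also have "\<dots> \<le> dual_volume_rate K (\<lambda>_. 1)"
    unfolding dual_volume_rate_def
    using w(2) integrable_continuous(2)[OF continuous_on_radial_density[OF K]]
    by (intro integral_mono) (auto simp: space_sphere_measure)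
  finally show ?thesis .
qed

text \<open>If the dual volume decreases to first order, the perturbed bodies compete with the minimiser for
  small \<open>t\<close>, so their entropy is no smaller, and neither is the integral that bounds it from above.\<close>

lemma entropy_rate_nonneg:
  assumes K: "K \<in> convex_bodies_o"
    and min: "\<And>L. L \<in> convex_bodies_o \<Longrightarrow> dual_volume L \<le> dual_volume K \<Longrightarrow> entropy K \<le> entropy L"
    and g: "continuous_on S g" and pos: "0 < dual_volume_rate K g"
  shows "0 \<le> entropy_rate K g"
proof -
  define t :: "nat \<Rightarrow> real" where "t n = 1 / real (Suc n)" for n
  have "t \<longlonglongrightarrow> 0" unfolding t_def by (rule LIMSEQ_Suc[OF lim_1_over_n])
  then have t: "\<And>n. 0 < t n" "\<And>n. t n \<le> 1" "t \<longlonglongrightarrow> 0" by (auto simp: t_def)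
  let ?K = "\<lambda>n. log_perturbation K g (t n)"
  note L = log_perturbation_convex_body[OF K g]
  have "(\<lambda>n. (dual_volume (?K n) - dual_volume K) / t n) \<longlonglongrightarrow> - dual_volume_rate K g"
    unfolding dual_volume_rate_def by (rule dual_volume_variation[OF K g t])
  then have "\<forall>\<^sub>F n in sequentially. (dual_volume (?K n) - dual_volume K) / t n < 0"
    using pos by (intro order_tendstoD) auto
  then have ev: "\<forall>\<^sub>F n in sequentially.
      0 \<le> ((LINT v|\<mu>. log_potential \<psi> (support_fun K v * exp (t n * g v))) - entropy K) / t n"
  proof eventually_elim
    case (elim n)
    then have "dual_volume (?K n) \<le> dual_volume K" using t(1)[of n] by (simp add: divide_less_0_iff)
    then have "entropy K \<le> entropy (?K n)" by (intro min L)
    also have "\<dots> \<le> (LINT v|\<mu>. log_potential \<psi> (support_fun K v * exp (t n * g v)))"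
      by (intro entropy_mono L support_fun_log_perturbation_le[OF K g] continuous_intros
          continuous_on_support_fun[OF K] g)
    finally show ?case using t(1)[of n] by simp
  qed
  have "(\<lambda>n. ((LINT v|\<mu>. log_potential \<psi> (support_fun K v * exp (t n * g v))) - entropy K) / t n)
    \<longlonglongrightarrow> entropy_rate K g"
    unfolding entropy_rate_def by (rule entropy_variation[OF K g t])
  then show ?thesis by (rule tendsto_lowerbound[OF _ ev]) simp
qed

text \<open>Lagrange multiplier rule: a linear functional that is nonnegative wherever another, nonzero one is
  positive is a multiple of the latter.\<close>

lemma rates_proportional:
  assumes K: "K \<in> convex_bodies_o"
    and min: "\<And>L. L \<in> convex_bodies_o \<Longrightarrow> dual_volume L \<le> dual_volume K \<Longrightarrow> entropy K \<le> entropy L"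
    and g: "continuous_on S g"
  shows "entropy_rate K g = entropy_rate K (\<lambda>_. 1) / dual_volume_rate K (\<lambda>_. 1) * dual_volume_rate K g"
proof -
  let ?A = "dual_volume_rate K (\<lambda>_. 1)" and ?B = "entropy_rate K (\<lambda>_. 1)"
  have A: "0 < ?A" by (rule dual_volume_rate_one_pos[OF K])
  define a where "a = dual_volume_rate K g / ?A"
  \<comment> \<open>For \<open>s = 1\<close> and \<open>s = - 1\<close>, the variation \<open>s * (g - a) + e\<close> has positive volume rate \<open>e * ?A\<close>.\<close>
  have "0 \<le> s * (entropy_rate K g - a * ?B) + e * ?B" if "0 < e" for e s
  proof -
    have "dual_volume_rate K (\<lambda>v. s * g v + (e - s * a)) = e * ?A"
      unfolding dual_volume_rate_affine[OF K g] using A by (simp add: a_def field_simps)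
    then have "0 \<le> entropy_rate K (\<lambda>v. s * g v + (e - s * a))"
      using that A by (intro entropy_rate_nonneg[OF K min] continuous_intros g) auto
    then show ?thesis unfolding entropy_rate_affine[OF K g] by (simp add: algebra_simps)
  qed
  then have "0 \<le> s * (entropy_rate K g - a * ?B)" for s by (rule nonneg_if_perturbed_nonneg)
  from this[of 1] this[of "- 1"] have "entropy_rate K g = a * ?B" by simp
  then show ?thesis by (simp add: a_def)
qed

text \<open>Away from singular directions, \<open>u\<close> lies in the reverse radial Gauss image of \<open>E\<close> exactly if the
  normal at \<open>u\<close> lies in \<open>E\<close>.\<close>

lemma curvature_measure_eq:
  assumes K: "K \<in> convex_bodies_o" and E: "E \<in> sets borel" "E \<subseteq> S"
  shows "dual_Orlicz_curvature_measure G \<psi> K E = - (1 / real DIM('a)) *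
    (LINT u|sphere_measure. radial_density K u * (indicator E (normal_choice K u) / \<psi> (support_fun K (normal_choice K u))))"
proof -
  let ?N = "singular_directions K" and ?n = "normal_choice K" and ?R = "reverse_radial_gauss_image K E"
  have null: "?N \<in> null_sets sphere_measure" by (rule singular_directions_null[OF K emeasure_sphere_finite])
  let ?f = "\<lambda>u. - (radial_density K u * (indicator E (?n u) / \<psi> (support_fun K (?n u))))"
  let ?h = "\<lambda>u. indicator ?R u *\<^sub>R (radial_fun K u * partial_t G (radial_fun K u) u
          / \<psi> (support_fun K (radial_gauss_map K u)))"
  have "(\<lambda>u. indicator E (?n u) :: real) \<in> borel_measurable sphere_measure"
    by (rule measurable_compose[OF measurable_normal_choice[OF K emeasure_sphere_finite]
          borel_measurable_indicator[OF E(1)]])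
  moreover have "(\<lambda>u. \<psi> (support_fun K (?n u))) \<in> borel_measurable sphere_measure"
    by (rule measurable_compose_normal_choice[OF K continuous_on_psi_support[OF K]])
  moreover have "radial_density K \<in> borel_measurable sphere_measure"
    by (intro borel_measurable_integrable integrable_continuous continuous_on_radial_density[OF K])
  ultimately have f: "?f \<in> borel_measurable sphere_measure" by measurable
  have eq: "?h u = ?f u" if u: "u \<in> S" "u \<notin> ?N" for u
  proof -
    have "u \<in> ?R \<longleftrightarrow> ?n u \<in> E"
      using touching_normal_unique[OF K u] normal_choice_touching[OF K u(1)] u(1)
      unfolding reverse_radial_gauss_image_eq[OF K E(2)] by blast
    then show ?thesis
      by (simp add: radial_gauss_map_eq_normal_choice[OF K u] radial_density_def indicator_def)
  qed
  have h: "?h \<in> borel_measurable sphere_measure"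
    by (rule measurable_sphere_measure_modify_null[OF f null eq]) auto
  have "AE u in sphere_measure. u \<notin> ?N" by (rule AE_not_in[OF null])
  then have "AE u in sphere_measure. ?h u = ?f u"
    by (rule AE_mp) (intro AE_I2 impI eq, auto simp: space_sphere_measure)
  then have "(LINT u|sphere_measure. ?h u) = (LINT u|sphere_measure. ?f u)"
    by (rule integral_cong_AE[OF h f])
  then show ?thesis
    unfolding dual_Orlicz_curvature_measure_def set_lebesgue_integral_def by simp
qed

text \<open>Testing the proportionality of the rates with \<open>g / \<psi> (support_fun K)\<close> exhibits \<open>\<mu>\<close> as the image
  under the normal map of a measure on the sphere of directions, which is a multiple of the curvature
  measure.\<close>

lemma measure_eq_curvature_measure:
  obtains K c where "K \<in> convex_bodies_o"
    "\<And>E. E \<in> sets borel \<Longrightarrow> E \<subseteq> S \<Longrightarrow> measure \<mu> E = c * dual_Orlicz_curvature_measure G \<psi> K E"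
proof -
  obtain K where K: "K \<in> convex_bodies_o"
    "\<And>L. L \<in> convex_bodies_o \<Longrightarrow> dual_volume L \<le> dual_volume K \<Longrightarrow> entropy K \<le> entropy L"
    using entropy_minimiser_exists by blast
  let ?n = "normal_choice K" and ?p = "\<lambda>v. \<psi> (support_fun K v)"
  define lam where "lam = entropy_rate K (\<lambda>_. 1) / dual_volume_rate K (\<lambda>_. 1)"
  have p: "0 < ?p v" if "v \<in> S" for v using that by (intro psi_pos support_fun_pos[OF K(1)])
  have "0 \<le> entropy_rate K (\<lambda>_. 1)"
    by (intro entropy_rate_nonneg[OF K] dual_volume_rate_one_pos K(1) continuous_intros)
  then have lam: "0 \<le> lam" using dual_volume_rate_one_pos[OF K(1)] by (simp add: lam_def)
  define w where "w u = lam * (radial_density K u * (1 / ?p (?n u)))" for u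
  have invp: "continuous_on S (\<lambda>v. 1 / ?p v)"
    using p by (intro continuous_intros continuous_on_psi_support[OF K(1)]) force
  have iw: "integrable sphere_measure w"
    unfolding w_def
    by (intro integrable_mult_right integrable_mult_compose_normal_choice[OF K(1) invp]
        continuous_on_radial_density K(1))
  have w0: "0 \<le> w u" if "u \<in> S" for u
    using lam radial_density_pos[OF K(1) that] p[OF normal_choice_in_sphere[OF K(1) that]]
    by (simp add: w_def)
  have wm: "w \<in> borel_measurable sphere_measure" using iw by (rule borel_measurable_integrable)
  have nm: "?n \<in> measurable sphere_measure borel" by (rule measurable_normal_choice[OF K(1) emeasure_sphere_finite])
  have nmd: "?n \<in> measurable (density sphere_measure w) borel" using nm by simp
  define M where "M = distr \<mu> borel (\<lambda>v. v)"
  define N where "N = distr (density sphere_measure w) borel ?n"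
  have idm: "(\<lambda>v. v) \<in> measurable \<mu> borel"
    unfolding measurable_cong_sets[OF sets_mu refl]
    by (rule borel_measurable_continuous_on_restrict) (intro continuous_intros)
  have finM: "finite_measure M" unfolding M_def by (rule mu.finite_measure_distr[OF idm])
  have "emeasure (density sphere_measure w) S = (\<integral>\<^sup>+u. ennreal (w u) \<partial>sphere_measure)"
    using wm by (subst emeasure_density)
      (auto simp: space_sphere_measure borel_subset_in_sets_sphere_measure intro!: nn_integral_cong)
  also have "\<dots> = ennreal (integral\<^sup>L sphere_measure w)"
    using w0 by (intro nn_integral_eq_integral iw AE_I2) (simp add: space_sphere_measure)
  finally have "finite_measure (density sphere_measure w)"
    by (intro finite_measureI) (simp add: space_sphere_measure)
  then have finN: "finite_measure N" unfolding N_def by (rule finite_measure.finite_measure_distr[OF _ nmd])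
  have intN: "integral\<^sup>L N f = (LINT u|sphere_measure. w u * f (?n u))"
    if f: "f \<in> borel_measurable borel" for f :: "'a \<Rightarrow> real"
  proof -
    have "integral\<^sup>L N f = (LINT u|density sphere_measure w. f (?n u))"
      unfolding N_def by (rule integral_distr[OF nmd f])
    also have "\<dots> = (LINT u|sphere_measure. w u *\<^sub>R f (?n u))"
      using w0 by (intro integral_density wm measurable_compose[OF nm f] AE_I2)
        (simp add: space_sphere_measure)
    finally show ?thesis by simp
  qed
  have "M = N"
  proof (rule finite_borel_measure_eqI[OF finM _ finN])
    show "sets M = sets borel" "sets N = sets borel" by (simp_all add: M_def N_def)
    fix g :: "'a \<Rightarrow> real" assume g: "continuous_on UNIV g"
    have gS: "continuous_on S g" using g by (rule continuous_on_subset) simp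
    have gb: "g \<in> borel_measurable borel" using g by (rule borel_measurable_continuous_onI)
    let ?k = "\<lambda>v. g v * (1 / ?p v)"
    have "integral\<^sup>L M g = (LINT v|\<mu>. g v)" unfolding M_def by (rule integral_distr[OF idm gb])
    also have "\<dots> = entropy_rate K ?k"
      unfolding entropy_rate_def
      by (intro Bochner_Integration.integral_cong refl) (use p in \<open>force simp: space_mu\<close>)
    also have "\<dots> = lam * dual_volume_rate K ?k"
      unfolding lam_def by (intro rates_proportional K continuous_on_mult gS invp)
    also have "\<dots> = (LINT u|sphere_measure. w u * g (?n u))"
      unfolding dual_volume_rate_def w_def by (simp add: ac_simps flip: integral_mult_right_zero)
    also have "\<dots> = integral\<^sup>L N g" by (rule intN[OF gb, symmetric])
    finally show "integral\<^sup>L M g = integral\<^sup>L N g" .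
  qed
  show thesis
  \<comment> \<open>The sign and the dimension come from the normalisation of the curvature measure.\<close>
  proof (rule that[OF K(1), of "- lam * real DIM('a)"])
    fix E :: "'a set" assume E: "E \<in> sets borel" "E \<subseteq> S"
    have "measure \<mu> E = measure M E"
      unfolding M_def using E idm
      by (subst measure_distr) (auto simp: space_mu Int_absorb2)
    also have "\<dots> = measure N E" by (simp only: \<open>M = N\<close>)
    also have "\<dots> = integral\<^sup>L N (indicator E)"
      by (simp add: N_def)
    also have "\<dots> = (LINT u|sphere_measure. w u * indicator E (?n u))"
      using E(1) by (intro intN) simp
    also have "\<dots> = lam * (LINT u|sphere_measure. radial_density K u * (indicator E (?n u) / ?p (?n u)))"
      unfolding w_def by (simp add: ac_simps flip: integral_mult_right_zero)
    finally show "measure \<mu> E = - lam * real DIM('a) * dual_Orlicz_curvature_measure G \<psi> K E"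
      unfolding curvature_measure_eq[OF K(1) E] by simp
  qed
qed

end

theorem theorem6p4:
  fixes \<mu> :: "(real ^ 'n) measure"
    and G :: "real \<Rightarrow> real ^ 'n \<Rightarrow> real"
    and \<psi> :: "real \<Rightarrow> real"
    and \<epsilon>\<^sub>0 :: real
  assumes mu_Borel: "finite_Borel_measure_on_sphere \<mu>"
    and mu_nonzero: "measure \<mu> (sphere 0 1) \<noteq> 0"
    and mu_hemisphere: "not_concentrated_on_closed_hemisphere \<mu>"
    and G_pos: "\<And>t u. 0 < t \<Longrightarrow> u \<in> sphere 0 1 \<Longrightarrow> 0 < G t u"
    and G_diff: "\<And>t u. 0 < t \<Longrightarrow> u \<in> sphere 0 1 \<Longrightarrow> (\<lambda>s. G s u) differentiable (at t)"
    and G_cont: "continuous_on ({0<..} \<times> sphere 0 1) (\<lambda>(t, u). G t u)"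
    and Gt_cont: "continuous_on ({0<..} \<times> sphere 0 1) (\<lambda>(t, u). partial_t G t u)"
    and Gt_neg: "\<And>t u. 0 < t \<Longrightarrow> u \<in> sphere 0 1 \<Longrightarrow> partial_t G t u < 0"
    and eps0: "0 < \<epsilon>\<^sub>0" "\<epsilon>\<^sub>0 < 1"
    and G_lim_0: "\<And>v \<epsilon>. v \<in> sphere 0 1 \<Longrightarrow> 0 < \<epsilon> \<Longrightarrow> \<epsilon> \<le> \<epsilon>\<^sub>0 \<Longrightarrow>
      filterlim (\<lambda>t. LINT u : sphere_cap \<epsilon> v | sphere_measure. G t u) at_top (at_right 0)"
    and G_lim_infinity:
      "((\<lambda>t. LINT u : sphere 0 1 | sphere_measure. G t u) \<longlongrightarrow> 0) at_top"
    and psi_pos: "\<And>s. 0 < s \<Longrightarrow> 0 < \<psi> s"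
    and psi_cont: "continuous_on {0<..} \<psi>"
    and psi_int: "(\<integral>\<^sup>+ s \<in> {1..}. ennreal (\<psi> s / s) \<partial>lborel) = \<infinity>"
  shows "\<exists>K \<in> convex_bodies_o. \<forall>E \<in> sets (restrict_space borel (sphere 0 1)).
    measure \<mu> E / measure \<mu> (sphere 0 1) =
      dual_Orlicz_curvature_measure G \<psi> K E
        / dual_Orlicz_curvature_measure G \<psi> K (sphere 0 1)"
proof -
  interpret dual_Orlicz_problem \<mu> G \<psi> \<epsilon>\<^sub>0
    by unfold_locales (fact assms)+
  obtain K c where K: "K \<in> convex_bodies_o"
    and c: "\<And>E. E \<in> sets borel \<Longrightarrow> E \<subseteq> sphere 0 1 \<Longrightarrow>
      measure \<mu> E = c * dual_Orlicz_curvature_measure G \<psi> K E"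
    using measure_eq_curvature_measure by blast
  show ?thesis
  proof (intro bexI[OF _ K] ballI)
    fix E :: "(real ^ 'n) set" assume "E \<in> sets (restrict_space borel (sphere 0 1))"
    then have E: "E \<in> sets borel" "E \<subseteq> sphere 0 1"
      by (auto simp: sets_restrict_space_iff)
    have S: "measure \<mu> (sphere 0 1) = c * dual_Orlicz_curvature_measure G \<psi> K (sphere 0 1)"
      by (intro c) auto
    then have "c \<noteq> 0" using mu_nonzero by auto
    then show "measure \<mu> E / measure \<mu> (sphere 0 1) =
      dual_Orlicz_curvature_measure G \<psi> K E / dual_Orlicz_curvature_measure G \<psi> K (sphere 0 1)"
      unfolding S c[OF E] by simp
  qed
qed

end
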